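(* Let $N\ge 3$, $k\in\{1,\dots,N-1\}$, $a>0$ and $\alpha>0$, and let $Q_\alpha=\mathbb{1}_{L_\alpha}$ be the characteristic function of $$L_\alpha=\{x=(x^{(N-k)},x^{(k)})\in\mathbb{R}^{N-k}\times\mathbb{R}^k:\ |x^{(N-k)}|\le a\,|x^{(k)}|^{-\alpha}\}.$$ Suppose that $\alpha>\frac{1}{N-1}$ if $k=1$, and that $\alpha<N-1$ if $k=N-1$. Define $$\lambda_{N,k,\alpha}=\begin{cases}\dfrac{2(N-1)-\frac{2}{\alpha}}{N-2}, & k=1,\\[2mm] \max\Big\{\dfrac{2(N-k)-\frac{2k}{\alpha}}{N-k-1},\ \dfrac{2k-2\alpha(N-k)}{k-1}\Big\}, & 2\le k\le N-2,\\[2mm] \dfrac{2(N-1)-2\alpha}{N-2}, & k=N-1.\end{cases}$$ Then $(G_k,q,Q_\alpha)$ is an admissible extension triple for every $q\ge 1$ with $q>\lambda_{N,k,\alpha}$.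
   Context: For $F\in L^2(\mathbb{S}^{N-1})$ (with $d\sigma$ the surface measure on the unit sphere $\mathbb{S}^{N-1}\subset\mathbb{R}^N$) set $\check F_\sigma(x)=(2\pi)^{-N/2}\int_{\mathbb{S}^{N-1}}e^{i\omega\cdot x}F(\omega)\,d\sigma(\omega)$. For a closed subgroup $G\subset O(N)$, a function $F$ on $\mathbb{S}^{N-1}$ is $G$-invariant if $F(A\theta)=F(\theta)$ for all $\theta\in\mathbb{S}^{N-1}$, $A\in G$. Given $q\ge1$, a closed subgroup $G\subset O(N)$ and a measurable $Q:\mathbb{R}^N\to\mathbb{C}$, the triple $(G,q,Q)$ is called an admissible extension triple if there is $C>0$ with $\|Q\check F_\sigma\|_{L^q(\mathbb{R}^N)}\le C\|F\|_{L^2(\mathbb{S}^{N-1})}$ for every $G$-invariant $F\in L^2(\mathbb{S}^{N-1})$. Points of $\mathbb{R}^N$ are written $x=(x^{(N-k)},x^{(k)})\in\mathbb{R}^{N-k}\times\mathbb{R}^k$, and $G_k=O(N-k)\times O(k)\subset O(N)$ acts blockwise on these two factors. *)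

theory Defs
  imports "HOL-Analysis.Analysis"
begin

text \<open>Surface measure on the unit sphere of a Euclidean space, defined as the cone
  measure: sigma(A) = N * Leb({t w : 0 < t < 1, w in A}), i.e. the push-forward of
  N times Lebesgue measure on the punctured unit ball under x maps to x / |x|.\<close>
definition sphere_measure :: "('a::euclidean_space) measure" where
  "sphere_measure =
     distr (density (restrict_space lborel (ball 0 1 - {0})) (\<lambda>_. ennreal (real DIM('a))))
           (restrict_space borel (sphere 0 1)) (\<lambda>x. x /\<^sub>R norm x)"

definition L2_sphere :: "('a::euclidean_space \<Rightarrow> complex) \<Rightarrow> bool" where
  "L2_sphere F \<longleftrightarrow> F \<in> borel_measurable sphere_measure \<and>
     integrable sphere_measure (\<lambda>\<omega>. (norm (F \<omega>))\<^sup>2)"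

definition L2_norm_sphere :: "('a::euclidean_space \<Rightarrow> complex) \<Rightarrow> real" where
  "L2_norm_sphere F = sqrt (integral\<^sup>L sphere_measure (\<lambda>\<omega>. (norm (F \<omega>))\<^sup>2))"

definition ext_sigma :: "('a::euclidean_space \<Rightarrow> complex) \<Rightarrow> 'a \<Rightarrow> complex" where
  "ext_sigma F x = complex_of_real ((2 * pi) powr (- real DIM('a) / 2)) *
     integral\<^sup>L sphere_measure (\<lambda>\<omega>. cis (\<omega> \<bullet> x) * F \<omega>)"

definition G_invariant :: "('a::euclidean_space \<Rightarrow> 'a) set \<Rightarrow> ('a \<Rightarrow> complex) \<Rightarrow> bool" where
  "G_invariant G F \<longleftrightarrow> (\<forall>A\<in>G. \<forall>\<theta>\<in>sphere 0 1. F (A \<theta>) = F \<theta>)"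

definition admissible_triple ::
    "('a::euclidean_space \<Rightarrow> 'a) set \<Rightarrow> real \<Rightarrow> ('a \<Rightarrow> complex) \<Rightarrow> bool" where
  "admissible_triple G q Q \<longleftrightarrow> (\<exists>C>0. \<forall>F. L2_sphere F \<and> G_invariant G F \<longrightarrow>
      (\<integral>\<^sup>+ x. ennreal (norm (Q x * ext_sigma F x) powr q) \<partial>lborel)
        \<le> ennreal ((C * L2_norm_sphere F) powr q))"

definition Gk :: "((real^'m) \<times> (real^'k) \<Rightarrow> (real^'m) \<times> (real^'k)) set" where
  "Gk = {(\<lambda>(u, v). (A u, B v)) | A B.
           orthogonal_transformation A \<and> orthogonal_transformation B}"

text \<open>L_alpha; points with x^(k) = 0 belong to it (|x^(k)|^(-alpha) = infinity).\<close>
definition L_alpha :: "real \<Rightarrow> real \<Rightarrow> ((real^'m) \<times> (real^'k)) set" where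
  "L_alpha a \<alpha> = {(u, v). v = 0 \<or> norm u \<le> a * norm v powr (- \<alpha>)}"

definition lambda_Nk :: "nat \<Rightarrow> nat \<Rightarrow> real \<Rightarrow> real" where
  "lambda_Nk N k \<alpha> =
    (if k = 1 then (2 * (real N - 1) - 2 / \<alpha>) / (real N - 2)
     else if k = N - 1 then (2 * (real N - 1) - 2 * \<alpha>) / (real N - 2)
     else max ((2 * (real N - real k) - 2 * real k / \<alpha>) / (real N - real k - 1))
              ((2 * real k - 2 * \<alpha> * (real N - real k)) / (real k - 1)))"

end

theory Submission
  imports Defs
begin

text \<open>
  Write \<open>x = (u, v)\<close> and \<open>m = N - k\<close>. By \<open>G\<^sub>k\<close>-invariance the extension of \<open>F\<close> takes the same
  value at \<open>(\<bar>u\<bar> p, \<bar>v\<bar> q)\<close> for all unit vectors \<open>p\<close>, \<open>q\<close>. Averaging over them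
  replaces the exponential by the product of the Fourier transforms of the two sphere measures
  at \<open>\<bar>u\<bar> \<omega>\<^sub>m\<close> and \<open>\<bar>v\<bar> \<omega>\<^sub>k\<close>. In dimension \<open>d\<close> such a transform is radial and decays like
  \<open>r\<^bsup>-(d-1)/2\<^esup>\<close>, by an energy estimate for the Bessel equation it satisfies. Since
  \<open>\<bar>\<omega>\<^sub>m\<bar>\<^bsup>-(m-1)\<^esup> \<bar>\<omega>\<^sub>k\<bar>\<^bsup>-(k-1)\<^esup>\<close> is integrable on the sphere, Cauchy-Schwarz bounds the extension
  pointwise by a multiple of \<open>max(1,\<bar>u\<bar>)\<^bsup>-(m-1)/2\<^esup> max(1,\<bar>v\<bar>)\<^bsup>-(k-1)/2\<^esup>\<close> times the norm of \<open>F\<close>.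
  The \<open>q\<close>-th power of this bound is integrable over the two horns of \<open>L\<^sub>\<alpha>\<close> exactly under the
  stated conditions.
\<close>

section \<open>Rotation invariance of Lebesgue and surface measure\<close>

lemma nn_integral_lborel_shift:
  fixes f :: "'a::euclidean_space \<Rightarrow> ennreal"
  assumes [measurable]: "f \<in> borel_measurable borel"
  shows "(\<integral>\<^sup>+x. f (c + x) \<partial>lborel) = (\<integral>\<^sup>+x. f x \<partial>lborel)"
  by (subst (2) lborel_distr_plus[of c, symmetric]) (simp add: nn_integral_distr)

text \<open>A Haar-type uniqueness argument without determinants. \<open>A\<close> and the unit ball
  enter one double integral; shifting \<open>x\<close> by \<open>T y\<close>, exchanging the
  integrals and shifting \<open>y\<close> by a preimage of \<open>- x\<close> moves \<open>T\<close>
  from the ball onto \<open>A\<close>. The ball is invariant under \<open>T\<close>, which fixes the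
  constant to 1.\<close>

lemma lborel_distr_orthogonal:
  fixes T :: "'a::euclidean_space \<Rightarrow> 'a"
  assumes T: "orthogonal_transformation T"
  shows "distr lborel borel T = lborel"
proof (rule measure_eqI)
  fix A assume "A \<in> sets (distr lborel borel T)"
  then have A [measurable]: "A \<in> sets borel" by simp
  have lin: "linear T" and norm_T: "norm (T x) = norm x" for x
    using T by (auto simp: orthogonal_transformation)
  have T_meas [measurable]: "T \<in> borel_measurable borel"
    using lin by (intro borel_measurable_continuous_onI linear_continuous_on)
      (simp add: linear_conv_bounded_linear)
  obtain T' where T': "\<And>x. T (T' x) = x"
    using orthogonal_transformation_surj[OF T] by (metis surjD)
  let ?B = "ball 0 1 :: 'a set"
  have B [measurable]: "?B \<in> sets borel" by simp
  let ?v = "emeasure lborel ?B"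
  \<comment> \<open>The ball volume is cancelled at the end, which in \<open>ennreal\<close>
    requires it to be neither zero nor infinite.\<close>
  have v: "?v \<noteq> 0" "?v \<noteq> \<infinity>"
    using unit_ball_vol_pos[of "real DIM('a)"] by (auto simp: emeasure_ball simp del: unit_ball_vol_pos)
  have "emeasure lborel A * ?v = (\<integral>\<^sup>+y. \<integral>\<^sup>+x. indicator A x * indicator ?B (T y) \<partial>lborel \<partial>lborel)"
  proof -
    have "indicator ?B (T y) = (indicator ?B y :: ennreal)" for y
      by (simp add: indicator_def norm_T)
    then show ?thesis
      by (simp add: nn_integral_multc nn_integral_cmult)
  qed
  also have "\<dots> = (\<integral>\<^sup>+y. \<integral>\<^sup>+x. indicator A (T y + x) * indicator ?B (T y) \<partial>lborel \<partial>lborel)"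
    by (intro nn_integral_cong nn_integral_lborel_shift[symmetric]) measurable
  also have "\<dots> = (\<integral>\<^sup>+x. \<integral>\<^sup>+y. indicator A (T y + x) * indicator ?B (T y) \<partial>lborel \<partial>lborel)"
    by (rule lborel_pair.Fubini') measurable
  also have "\<dots> = (\<integral>\<^sup>+x. \<integral>\<^sup>+y. indicator A (T y) * indicator ?B (T y - x) \<partial>lborel \<partial>lborel)"
  proof (rule nn_integral_cong)
    fix x :: 'a
    have "(\<integral>\<^sup>+y. indicator A (T (T' (- x) + y) + x) * indicator ?B (T (T' (- x) + y)) \<partial>lborel)
        = (\<integral>\<^sup>+y. indicator A (T y + x) * indicator ?B (T y) \<partial>lborel)"
      by (rule nn_integral_lborel_shift) measurable
    then show "(\<integral>\<^sup>+y. indicator A (T y + x) * indicator ?B (T y) \<partial>lborel)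
      = (\<integral>\<^sup>+y. indicator A (T y) * indicator ?B (T y - x) \<partial>lborel)"
      by (simp add: linear_add[OF lin] T')
  qed
  also have "\<dots> = (\<integral>\<^sup>+y. \<integral>\<^sup>+x. indicator A (T y) * indicator ?B (T y - x) \<partial>lborel \<partial>lborel)"
    by (rule lborel_pair.Fubini'[symmetric]) measurable
  also have "\<dots> = (\<integral>\<^sup>+y. indicator A (T y) * ?v \<partial>lborel)"
  proof (intro nn_integral_cong)
    fix y :: 'a
    have eq: "indicator ?B (T y - x) = (indicator (ball (T y) 1) x :: ennreal)" for x
      by (auto simp: indicator_def dist_norm norm_minus_commute)
    show "(\<integral>\<^sup>+x. indicator A (T y) * indicator ?B (T y - x) \<partial>lborel) = indicator A (T y) * ?v"
      unfolding eq by (subst nn_integral_cmult_indicator) (simp_all add: emeasure_ball)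
  qed
  also have "\<dots> = (\<integral>\<^sup>+y. indicator A (T y) \<partial>lborel) * ?v"
    by (rule nn_integral_multc) measurable
  also have "(\<integral>\<^sup>+y. indicator A (T y) \<partial>lborel) = emeasure (distr lborel borel T) A"
    by (simp add: nn_integral_distr flip: nn_integral_indicator)
  finally have "emeasure (distr lborel borel T) A * ?v = emeasure lborel A * ?v" ..
  then have "?v * emeasure (distr lborel borel T) A = ?v * emeasure lborel A"
    by (simp add: mult.commute)
  then show "emeasure (distr lborel borel T) A = emeasure lborel A"
    using v by (simp add: ennreal_mult_cancel_left)
qed simp

section \<open>The cone surface measure and its orthogonal invariance\<close>

lemma sets_sphere_measure [measurable_cong]:
  "sets (sphere_measure :: 'a::euclidean_space measure) = sets (restrict_space borel (sphere 0 1))"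
  by (simp add: sphere_measure_def)

lemma space_sphere_measure [simp]:
  "space (sphere_measure :: 'a::euclidean_space measure) = sphere 0 1"
  by (simp add: sphere_measure_def space_restrict_space)

lemma measurable_radial_projection:
  "(\<lambda>x::'a::euclidean_space. x /\<^sub>R norm x) \<in>
     restrict_space borel (ball 0 1 - {0}) \<rightarrow>\<^sub>M restrict_space borel (sphere 0 1)"
proof (rule measurable_restrict_space3)
  show "(\<lambda>x::'a. x /\<^sub>R norm x) \<in> borel \<rightarrow>\<^sub>M borel" by measurable
  show "(\<lambda>x::'a. x /\<^sub>R norm x) \<in> ball 0 1 - {0} \<rightarrow> sphere 0 1" by auto
qed

lemma measurable_radial_projection':
  "(\<lambda>x::'a::euclidean_space. x /\<^sub>R norm x) \<in>
     measurable (density (restrict_space lborel (ball 0 1 - {0})) f) (restrict_space borel (sphere 0 1))"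
  using measurable_radial_projection
  by (subst measurable_cong_sets[OF _ refl, where M'="restrict_space borel (ball 0 1 - {0})"])
     (simp_all add: sets_restrict_space_cong[OF sets_lborel])

text \<open>Total mass, invariance and the finiteness of the kernel integral are all read off from
  this Lebesgue integral over the punctured ball.\<close>

lemma nn_integral_sphere_measure:
  fixes f :: "'a::euclidean_space \<Rightarrow> ennreal"
  assumes "f \<in> borel_measurable sphere_measure"
  shows "(\<integral>\<^sup>+\<omega>. f \<omega> \<partial>sphere_measure) =
    ennreal (real DIM('a)) * (\<integral>\<^sup>+x. f (x /\<^sub>R norm x) * indicator (ball 0 1 - {0}) x \<partial>lborel)"
proof -
  have f [measurable]: "f \<in> borel_measurable (restrict_space borel (sphere 0 1))"
    using assms by (simp cong: measurable_cong_sets add: sets_sphere_measure)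
  have m [measurable]: "(\<lambda>x. f (x /\<^sub>R norm x)) \<in> borel_measurable (restrict_space lborel (ball 0 1 - {0}))"
    using measurable_compose[OF measurable_radial_projection f]
    by (subst measurable_cong_sets[OF _ refl, where M'="restrict_space borel (ball 0 1 - {0})"])
       (simp_all add: sets_restrict_space_cong[OF sets_lborel])
  have "(\<integral>\<^sup>+\<omega>. f \<omega> \<partial>sphere_measure) =
     (\<integral>\<^sup>+x. f (x /\<^sub>R norm x) \<partial>density (restrict_space lborel (ball 0 1 - {0})) (\<lambda>_. ennreal (real DIM('a))))"
    unfolding sphere_measure_def
    by (subst nn_integral_distr[OF measurable_radial_projection']) (simp_all add: f)
  also have "\<dots> = ennreal (real DIM('a)) * (\<integral>\<^sup>+x. f (x /\<^sub>R norm x) \<partial>restrict_space lborel (ball 0 1 - {0}))"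
    by (simp add: nn_integral_density nn_integral_cmult)
  also have "(\<integral>\<^sup>+x. f (x /\<^sub>R norm x) \<partial>restrict_space lborel (ball 0 1 - {0})) =
     (\<integral>\<^sup>+x. f (x /\<^sub>R norm x) * indicator (ball 0 1 - {0}) x \<partial>lborel)"
    by (rule nn_integral_restrict_space) simp
  finally show ?thesis .
qed

text \<open>The mass is the dimension times the unit ball volume, since removing the origin costs
  only a null set.\<close>

lemma finite_measure_sphere: "finite_measure (sphere_measure :: 'a::euclidean_space measure)"
  and emeasure_sphere_pos: "emeasure (sphere_measure :: 'a measure) (sphere 0 1) > 0"
proof -
  have *: "emeasure (sphere_measure :: 'a measure) (sphere 0 1) =
     ennreal (real DIM('a)) * emeasure lborel (ball 0 1 - {0} :: 'a set)"
    using nn_integral_sphere_measure[of "\<lambda>_::'a. 1"]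
    by simp
  have **: "emeasure lborel (ball 0 1 - {0} :: 'a set) = ennreal (unit_ball_vol (real DIM('a)))"
    by (subst emeasure_Diff_null_set) (auto simp: emeasure_ball)
  show "finite_measure (sphere_measure :: 'a measure)"
    by (rule finite_measureI) (simp add: * ** ennreal_mult_eq_top_iff)
  show "emeasure (sphere_measure :: 'a measure) (sphere 0 1) > 0"
    unfolding * ** by (simp add: ennreal_zero_less_mult_iff)
qed

lemma measure_sphere_pos: "measure (sphere_measure :: 'a::euclidean_space measure) (sphere 0 1) > 0"
  using emeasure_sphere_pos[where 'a='a] finite_measure.emeasure_eq_measure[OF finite_measure_sphere]
  by (metis ennreal_0 ennreal_less_zero_iff less_irrefl not_le_imp_less)

lemma measurable_orthogonal_sphere:
  fixes T :: "'a::euclidean_space \<Rightarrow> 'a"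
  assumes "orthogonal_transformation T"
  shows "T \<in> measurable sphere_measure sphere_measure"
proof -
  have lin: "linear T" and norm_T: "norm (T x) = norm x" for x
    using assms by (auto simp: orthogonal_transformation)
  have "T \<in> borel_measurable borel"
    using lin by (intro borel_measurable_continuous_onI linear_continuous_on)
      (simp add: linear_conv_bounded_linear)
  then have "T \<in> restrict_space borel (sphere 0 1) \<rightarrow>\<^sub>M restrict_space borel (sphere 0 1)"
    by (rule measurable_restrict_space3) (auto simp: norm_T)
  then show ?thesis
    by (simp cong: measurable_cong_sets add: sets_sphere_measure)
qed

text \<open>\<open>T\<close> is linear and norm preserving, so it commutes with the radial
  projection and respects the punctured ball; invariance is inherited from Lebesgue measure.\<close>

lemma sphere_measure_distr_orthogonal:
  fixes T :: "'a::euclidean_space \<Rightarrow> 'a"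
  assumes T: "orthogonal_transformation T"
  shows "distr sphere_measure sphere_measure T = sphere_measure"
proof (rule measure_eqI)
  fix A :: "'a set" assume "A \<in> sets (distr sphere_measure sphere_measure T)"
  then have A [measurable]: "A \<in> sets sphere_measure" by simp
  have lin: "linear T" and norm_T: "norm (T x) = norm x" for x
    using T by (auto simp: orthogonal_transformation)
  have [measurable]: "T \<in> borel_measurable borel"
    using lin by (intro borel_measurable_continuous_onI linear_continuous_on)
      (simp add: linear_conv_bounded_linear)
  have T_meas [measurable]: "T \<in> measurable sphere_measure sphere_measure"
    by (rule measurable_orthogonal_sphere[OF T])
  have T0: "T x = 0 \<longleftrightarrow> x = 0" for x
    using norm_T[of x] by (metis norm_eq_zero)
  have A' [measurable]: "A \<in> sets borel"
    using A by (auto simp: sets_sphere_measure sets_restrict_space_iff)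
  have g [measurable]: "(\<lambda>x. indicator A (x /\<^sub>R norm x) * indicator (ball 0 1 - {0}) x :: ennreal) \<in> borel_measurable borel"
  proof -
    have "(\<lambda>x. indicator A (x /\<^sub>R norm x) :: ennreal) \<in> borel_measurable borel"
      by (rule measurable_compose[OF _ borel_measurable_indicator[OF A']]) measurable
    then show ?thesis
      by (intro borel_measurable_times_ennreal borel_measurable_indicator) auto
  qed
  have "emeasure (distr sphere_measure sphere_measure T) A
      = (\<integral>\<^sup>+\<omega>. indicator A (T \<omega>) \<partial>sphere_measure)"
    by (simp add: nn_integral_distr flip: nn_integral_indicator)
  also have "\<dots> = ennreal (real DIM('a)) * (\<integral>\<^sup>+x. indicator A (T (x /\<^sub>R norm x)) * indicator (ball 0 1 - {0}) x \<partial>lborel)"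
    by (rule nn_integral_sphere_measure) measurable
  also have "(\<integral>\<^sup>+x. indicator A (T (x /\<^sub>R norm x)) * indicator (ball 0 1 - {0}) x \<partial>lborel)
     = (\<integral>\<^sup>+x. indicator A (T x /\<^sub>R norm (T x)) * indicator (ball 0 1 - {0}) (T x) \<partial>lborel)"
    by (simp add: norm_T linear_scale[OF lin] indicator_def T0 cong: if_cong)
  also have "\<dots> = (\<integral>\<^sup>+x. indicator A (x /\<^sub>R norm x) * indicator (ball 0 1 - {0}) x \<partial>distr lborel borel T)"
    by (subst nn_integral_distr) auto
  also have "\<dots> = (\<integral>\<^sup>+x. indicator A (x /\<^sub>R norm x) * indicator (ball 0 1 - {0}) x \<partial>lborel)"
    by (simp add: lborel_distr_orthogonal[OF T])
  also have "ennreal (real DIM('a)) * \<dots> = (\<integral>\<^sup>+\<omega>. indicator A \<omega> \<partial>sphere_measure)"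
    by (rule nn_integral_sphere_measure[symmetric]) measurable
  also have "\<dots> = emeasure sphere_measure A" by simp
  finally show "emeasure (distr sphere_measure sphere_measure T) A = emeasure sphere_measure A" .
qed simp

lemma integral_sphere_orthogonal:
  fixes T :: "'a::euclidean_space \<Rightarrow> 'a" and f :: "'a \<Rightarrow> 'b::{banach,second_countable_topology}"
  assumes T: "orthogonal_transformation T" and f: "f \<in> borel_measurable sphere_measure"
  shows "(\<integral>\<omega>. f (T \<omega>) \<partial>sphere_measure) = (\<integral>\<omega>. f \<omega> \<partial>sphere_measure)"
  using integral_distr[OF measurable_orthogonal_sphere[OF T] f] sphere_measure_distr_orthogonal[OF T]
  by simp

section \<open>Decay of the Fourier transform of surface measure\<close>

text \<open>The mean value inequality bounds every difference quotient by \<open>B\<close>, which is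
  integrable because the measure is finite; dominated convergence along sequences tending to
  \<open>t\<close> gives the derivative.\<close>

lemma DERIV_integral_finite_measure:
  fixes g g' :: "real \<Rightarrow> 'a \<Rightarrow> real"
  assumes fin: "finite_measure M"
    and int: "\<And>t. integrable M (g t)"
    and meas: "g' t \<in> borel_measurable M"
    and deriv: "\<And>t x. x \<in> space M \<Longrightarrow> ((\<lambda>t. g t x) has_real_derivative g' t x) (at t)"
    and bound: "\<And>t x. x \<in> space M \<Longrightarrow> \<bar>g' t x\<bar> \<le> B"
  shows "((\<lambda>t. \<integral>x. g t x \<partial>M) has_real_derivative (\<integral>x. g' t x \<partial>M)) (at t)"
  unfolding has_field_derivative_iff tendsto_at_iff_sequentially
proof (intro allI impI)
  fix X :: "nat \<Rightarrow> real" assume X: "\<forall>i. X i \<in> UNIV - {t}" "X \<longlonglongrightarrow> t"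
  interpret finite_measure M by fact
  have [measurable]: "g t \<in> borel_measurable M" for t
    using int by (rule borel_measurable_integrable)
  have "(\<lambda>i. \<integral>x. (g (X i) x - g t x) / (X i - t) \<partial>M) \<longlonglongrightarrow> (\<integral>x. g' t x \<partial>M)"
  proof (rule integral_dominated_convergence[where w = "\<lambda>_. B"])
    show "AE x in M. (\<lambda>i. (g (X i) x - g t x) / (X i - t)) \<longlonglongrightarrow> g' t x"
    proof (rule AE_I2)
      fix x assume "x \<in> space M"
      from deriv[OF this, of t] X show "(\<lambda>i. (g (X i) x - g t x) / (X i - t)) \<longlonglongrightarrow> g' t x"
        unfolding has_field_derivative_iff tendsto_at_iff_sequentially by (auto simp: o_def)
    qed
    show "AE x in M. norm ((g (X i) x - g t x) / (X i - t)) \<le> B" for i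
    proof (rule AE_I2)
      fix x assume x: "x \<in> space M"
      have "norm (g (X i) x - g t x) \<le> B * norm (X i - t)"
        by (rule field_differentiable_bound[of UNIV "\<lambda>t. g t x" "\<lambda>t. g' t x"])
           (use x deriv bound in auto)
      with X show "norm ((g (X i) x - g t x) / (X i - t)) \<le> B"
        by (auto simp: divide_le_eq)
    qed
  qed (use meas in auto)
  then show "((\<lambda>y. ((\<integral>x. g y x \<partial>M) - (\<integral>x. g t x \<partial>M)) / (y - t)) \<circ> X) \<longlonglongrightarrow> (\<integral>x. g' t x \<partial>M)"
    by (simp add: o_def int)
qed

section \<open>Radiality of the surface Fourier transform and its Bessel equation\<close>

lemma borel_measurable_sphere_measure:
  assumes "f \<in> borel_measurable borel"
  shows "f \<in> borel_measurable (sphere_measure :: 'a::euclidean_space measure)"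
  using measurable_restrict_space1[OF assms]
  by (simp cong: measurable_cong_sets add: sets_sphere_measure)

lemma integrable_sphere_bounded:
  fixes f :: "'a::euclidean_space \<Rightarrow> 'b::{banach,second_countable_topology}"
  assumes "f \<in> borel_measurable borel" "\<And>\<omega>. norm \<omega> = 1 \<Longrightarrow> norm (f \<omega>) \<le> B"
  shows "integrable sphere_measure f"
  using assms
  by (intro finite_measure.integrable_const_bound[OF finite_measure_sphere, of _ B]
      borel_measurable_sphere_measure AE_I2) auto

text \<open>The Fourier transform of the surface measure, up to normalisation. The sine part
  vanishes by antipodal symmetry; the cosine form keeps the profile real for the differential
  equation.\<close>

definition sphere_cos :: "real^'n \<Rightarrow> real" where
  "sphere_cos w = (\<integral>\<omega>. cos (\<omega> \<bullet> w) \<partial>sphere_measure)"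

text \<open>An orthogonal \<open>T\<close> carrying \<open>v\<close> to \<open>w\<close> satisfies
  \<open>T \<omega> \<bullet> w = \<omega> \<bullet> v\<close>, and the surface measure is invariant
  under \<open>T\<close>.\<close>

lemma sphere_cos_norm_eq:
  fixes v w :: "real^'n"
  assumes "norm v = norm w"
  shows "sphere_cos v = sphere_cos w"
proof -
  obtain T :: "real^'n \<Rightarrow> real^'n" where T: "orthogonal_transformation T" "T v = w"
    using orthogonal_transformation_exists[OF assms] by blast
  have "sphere_cos w = (\<integral>\<omega>. cos (T \<omega> \<bullet> w) \<partial>sphere_measure)"
    unfolding sphere_cos_def
    by (rule integral_sphere_orthogonal[OF T(1), symmetric])
       (intro borel_measurable_sphere_measure, measurable)
  also have "\<dots> = sphere_cos v"
  proof -
    have "T \<omega> \<bullet> w = \<omega> \<bullet> v" for \<omega>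
      using T by (auto simp: orthogonal_transformation_def)
    then show ?thesis by (simp add: sphere_cos_def)
  qed
  finally show ?thesis ..
qed

lemma abs_inner_le_1: "norm x = 1 \<Longrightarrow> norm y = 1 \<Longrightarrow> \<bar>x \<bullet> y\<bar> \<le> 1"
  using Cauchy_Schwarz_ineq2[of x y] by simp

lemma abs_mult_le_mult: "\<bar>x\<bar> \<le> (a::real) \<Longrightarrow> \<bar>y\<bar> \<le> b \<Longrightarrow> \<bar>x * y\<bar> \<le> a * b"
  by (simp add: abs_mult mult_mono')

text \<open>The sphere average of \<open>cos (r \<omega> \<bullet> a\<^sub>t)\<close> with \<open>a\<^sub>t = cos t a + sin t b\<close> does not depend on
  \<open>t\<close>; the identity is its second derivative at \<open>t = 0\<close>.\<close>
lemma sphere_rotation_identity: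
  fixes a b :: "real^'n"
  assumes ab: "norm a = 1" "norm b = 1" "a \<bullet> b = 0" and r: "r > 0"
  shows "(\<integral>\<omega>. (\<omega> \<bullet> a) * sin (r * (\<omega> \<bullet> a)) \<partial>sphere_measure) =
         r * (\<integral>\<omega>. (\<omega> \<bullet> b)\<^sup>2 * cos (r * (\<omega> \<bullet> a)) \<partial>sphere_measure)"
proof -
  let ?S = "sphere_measure :: (real^'n) measure"
  \<comment> \<open>The coordinates of \<omega> along the rotating vector
    \<open>cos t a + sin t b\<close> and along its derivative in \<open>t\<close>; hence
    \<open>A' = B\<close> and \<open>B' = - A\<close>.\<close>
  define A where "A t \<omega> = cos t * (\<omega> \<bullet> a) + sin t * (\<omega> \<bullet> b)" for t and \<omega> :: "real^'n"
  define B where "B t \<omega> = - sin t * (\<omega> \<bullet> a) + cos t * (\<omega> \<bullet> b)" for t and \<omega> :: "real^'n"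
  have meas [measurable]: "A t \<in> borel_measurable borel" "B t \<in> borel_measurable borel" for t
    unfolding A_def B_def by measurable
  have AB': "((\<lambda>t. A t \<omega>) has_real_derivative B t \<omega>) (at t)"
    "((\<lambda>t. B t \<omega>) has_real_derivative - A t \<omega>) (at t)" for t \<omega>
    unfolding A_def B_def by (auto intro!: derivative_eq_intros)
  have bnd: "\<bar>A t \<omega>\<bar> \<le> 2" "\<bar>B t \<omega>\<bar> \<le> 2" if "norm \<omega> = 1" for t \<omega>
  proof -
    have "\<bar>cos t * (\<omega> \<bullet> a)\<bar> \<le> 1 * 1" "\<bar>sin t * (\<omega> \<bullet> b)\<bar> \<le> 1 * 1"
      "\<bar>sin t * (\<omega> \<bullet> a)\<bar> \<le> 1 * 1" "\<bar>cos t * (\<omega> \<bullet> b)\<bar> \<le> 1 * 1"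
      using that ab by (intro abs_mult_le_mult abs_inner_le_1; simp)+
    then show "\<bar>A t \<omega>\<bar> \<le> 2" "\<bar>B t \<omega>\<bar> \<le> 2"
      by (auto simp: A_def B_def)
  qed
  have const: "(\<integral>\<omega>. cos (r * A t \<omega>) \<partial>?S) = sphere_cos (r *\<^sub>R a)" for t
  proof -
    have "(norm (cos t *\<^sub>R a + sin t *\<^sub>R b))\<^sup>2 = 1"
    proof -
      have "(norm (cos t *\<^sub>R a + sin t *\<^sub>R b))\<^sup>2 = (cos t)\<^sup>2 * (norm a)\<^sup>2 + (sin t)\<^sup>2 * (norm b)\<^sup>2"
        using ab(3) by (subst norm_add_Pythagorean) (auto simp: orthogonal_def power_mult_distrib)
      then show ?thesis using ab by simp
    qed
    then have "norm (cos t *\<^sub>R a + sin t *\<^sub>R b) = 1"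
      by (simp add: power2_eq_1_iff) (smt (verit) norm_ge_zero)
    then have "sphere_cos (r *\<^sub>R (cos t *\<^sub>R a + sin t *\<^sub>R b)) = sphere_cos (r *\<^sub>R a)"
      using ab by (intro sphere_cos_norm_eq) simp
    then show ?thesis
      by (simp add: sphere_cos_def A_def inner_simps algebra_simps)
  qed
  have "((\<lambda>t. \<integral>\<omega>. cos (r * A t \<omega>) \<partial>?S) has_real_derivative (\<integral>\<omega>. - r * (B t \<omega> * sin (r * A t \<omega>)) \<partial>?S)) (at t)" for t
  proof (rule DERIV_integral_finite_measure[OF finite_measure_sphere, where B = "r * (2 * 1)"])
    show "integrable ?S (\<lambda>\<omega>. cos (r * A t \<omega>))" for t
      by (rule integrable_sphere_bounded[where B = 1]) measurable
    show "(\<lambda>\<omega>. - r * (B t \<omega> * sin (r * A t \<omega>))) \<in> borel_measurable ?S"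
      by (intro borel_measurable_sphere_measure) measurable
    show "((\<lambda>t. cos (r * A t \<omega>)) has_real_derivative - r * (B t \<omega> * sin (r * A t \<omega>))) (at t)" for t \<omega>
      by (rule derivative_eq_intros AB' refl)+ simp
    show "\<bar>- r * (B t \<omega> * sin (r * A t \<omega>))\<bar> \<le> r * (2 * 1)" if "\<omega> \<in> space ?S" for t \<omega>
      using that r by (intro abs_mult_le_mult bnd) auto
  qed
  moreover have "((\<lambda>t. \<integral>\<omega>. cos (r * A t \<omega>) \<partial>?S) has_real_derivative 0) (at t)" for t
    unfolding const by simp
  ultimately have "(\<integral>\<omega>. - r * (B t \<omega> * sin (r * A t \<omega>)) \<partial>?S) = 0" for t
    using DERIV_unique by blast
  \<comment> \<open>The first derivative vanishes for every \<open>t\<close>, not only at 0, so it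
    can be differentiated once more.\<close>
  then have zero: "(\<integral>\<omega>. B t \<omega> * sin (r * A t \<omega>) \<partial>?S) = 0" for t
    using r by simp
  have "((\<lambda>t. \<integral>\<omega>. B t \<omega> * sin (r * A t \<omega>) \<partial>?S) has_real_derivative
     (\<integral>\<omega>. r * ((B t \<omega>)\<^sup>2 * cos (r * A t \<omega>)) - A t \<omega> * sin (r * A t \<omega>) \<partial>?S)) (at t)" for t
  proof (rule DERIV_integral_finite_measure[OF finite_measure_sphere, where B = "r * ((2 * 2) * 1) + 2 * 1"])
    show "integrable ?S (\<lambda>\<omega>. B t \<omega> * sin (r * A t \<omega>))" for t
      by (rule integrable_sphere_bounded[where B = "2 * 1"])
         (measurable, unfold real_norm_def, intro abs_mult_le_mult bnd, auto)
    show "(\<lambda>\<omega>. r * ((B t \<omega>)\<^sup>2 * cos (r * A t \<omega>)) - A t \<omega> * sin (r * A t \<omega>)) \<in> borel_measurable ?S"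
      by (intro borel_measurable_sphere_measure) measurable
    show "((\<lambda>t. B t \<omega> * sin (r * A t \<omega>)) has_real_derivative
       r * ((B t \<omega>)\<^sup>2 * cos (r * A t \<omega>)) - A t \<omega> * sin (r * A t \<omega>)) (at t)" for t \<omega>
      by (rule derivative_eq_intros AB' refl)+ (simp add: power2_eq_square)
    show "\<bar>r * ((B t \<omega>)\<^sup>2 * cos (r * A t \<omega>)) - A t \<omega> * sin (r * A t \<omega>)\<bar> \<le> r * ((2 * 2) * 1) + 2 * 1"
      if "\<omega> \<in> space ?S" for t \<omega>
    proof (rule order_trans[OF abs_triangle_ineq4], rule add_mono)
      show "\<bar>r * ((B t \<omega>)\<^sup>2 * cos (r * A t \<omega>))\<bar> \<le> r * ((2 * 2) * 1)"
        unfolding power2_eq_square using that r by (intro abs_mult_le_mult bnd) auto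
      show "\<bar>A t \<omega> * sin (r * A t \<omega>)\<bar> \<le> 2 * 1"
        using that by (intro abs_mult_le_mult bnd) auto
    qed
  qed
  moreover have "((\<lambda>t. \<integral>\<omega>. B t \<omega> * sin (r * A t \<omega>) \<partial>?S) has_real_derivative 0) (at t)" for t
    unfolding zero by simp
  \<comment> \<open>At \<open>t = 0\<close> the rotating pair is \<open>a\<close>, \<open>b\<close>;
    the vanishing second derivative is the claim once the integral is split.\<close>
  ultimately have "(\<integral>\<omega>. r * ((B 0 \<omega>)\<^sup>2 * cos (r * A 0 \<omega>)) - A 0 \<omega> * sin (r * A 0 \<omega>) \<partial>?S) = 0"
    using DERIV_unique by blast
  moreover have "integrable ?S (\<lambda>\<omega>. r * ((B 0 \<omega>)\<^sup>2 * cos (r * A 0 \<omega>)))"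
    by (rule integrable_sphere_bounded[where B = "r * ((2 * 2) * 1)"])
       (measurable, unfold real_norm_def power2_eq_square, intro abs_mult_le_mult bnd, use r in auto)
  moreover have "integrable ?S (\<lambda>\<omega>. A 0 \<omega> * sin (r * A 0 \<omega>))"
    by (rule integrable_sphere_bounded[where B = "2 * 1"])
       (measurable, unfold real_norm_def, intro abs_mult_le_mult bnd, auto)
  ultimately show ?thesis
    by (simp add: A_def B_def)
qed

text \<open>Here \<open>r\<^bsup>n/2\<^esup> f\<close> solves \<open>y'' + (1 - c / r\<^sup>2) y = 0\<close> with \<open>c = n (n - 2) / 4\<close>, so the energy
  \<open>y'\<^sup>2 + y\<^sup>2\<close> multiplied by \<open>exp (\<bar>c\<bar> / r)\<close> does not increase.\<close>
lemma bessel_ode_decay: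
  fixes f f1 f2 :: "real \<Rightarrow> real"
  assumes f: "\<And>r. r > 0 \<Longrightarrow> (f has_real_derivative f1 r) (at r)"
    and f1: "\<And>r. r > 0 \<Longrightarrow> (f1 has_real_derivative f2 r) (at r)"
    and ode: "\<And>r. r > 0 \<Longrightarrow> r * (f2 r + f r) = - real n * f1 r"
  obtains C where "\<And>r. r \<ge> 1 \<Longrightarrow> r ^ n * (f r)\<^sup>2 \<le> C"
proof -
  define c where "c = \<bar>real n * (real n - 2) / 4\<bar>"
  \<comment> \<open>For \<open>y = r^(n/2) f\<close> one has \<open>y' = r^(n/2) z\<close>, so
    \<open>E\<close> below is the energy \<open>y'^2 + y^2\<close>.\<close>
  define z where "z r = f1 r + real n * f r / (2 * r)" for r
  define E where "E r = r ^ n * ((z r)\<^sup>2 + (f r)\<^sup>2)" for r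
  define G where "G r = E r * exp (c / r)" for r
  define E' where "E' r = r ^ n * (2 * (real n * (real n - 2) / 4) * z r * f r / r\<^sup>2)" for r
  have z': "(z has_real_derivative (- f r - real n / (2 * r) * z r + (real n * (real n - 2) / 4) * f r / r\<^sup>2)) (at r)"
    if r: "r > 0" for r
  proof -
    have f2: "f2 r = - f r - real n * f1 r / r"
      using ode[OF r] r by (simp add: field_simps)
    show ?thesis
      unfolding z_def[abs_def]
      using r by (auto intro!: derivative_eq_intros f f1 simp: f2 z_def field_simps power2_eq_square)
  qed
  \<comment> \<open>The truncated exponent \<open>n - Suc 0\<close> does no harm: for
    \<open>n = 0\<close> both sides are 0.\<close>
  have pow: "real n * r ^ (n - Suc 0) = r ^ n * (real n / r)" if "r > 0" for r :: real
    using that by (cases n) auto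
  have E: "(E has_real_derivative E' r) (at r)" if r: "r > 0" for r
  proof -
    have f1_eq: "f1 r = z r - real n * f r / (2 * r)"
      by (simp add: z_def)
    have "(E has_real_derivative
      (r ^ n * (real n / r)) * ((z r)\<^sup>2 + (f r)\<^sup>2) + r ^ n * (2 * z r * (- f r - real n / (2 * r) * z r + (real n * (real n - 2) / 4) * f r / r\<^sup>2)
        + 2 * f r * f1 r)) (at r)"
      unfolding E_def[abs_def]
      by (rule derivative_eq_intros f z' refl r)+ (use r pow[OF r] in \<open>simp add: algebra_simps\<close>)
    also have "(r ^ n * (real n / r)) * ((z r)\<^sup>2 + (f r)\<^sup>2) + r ^ n * (2 * z r * (- f r - real n / (2 * r) * z r + (real n * (real n - 2) / 4) * f r / r\<^sup>2)
        + 2 * f r * f1 r) = E' r"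
      unfolding f1_eq E'_def
      using r by (simp add: power2_eq_square divide_simps) (simp add: algebra_simps)
    finally show ?thesis .
  qed
  have G': "(G has_real_derivative (E' r - c / r\<^sup>2 * E r) * exp (c / r)) (at r)" if r: "r > 0" for r
    unfolding G_def[abs_def]
    using r by (auto intro!: derivative_eq_intros E simp: field_simps power2_eq_square)
  \<comment> \<open>Up to sign, \<open>E'\<close> is \<open>c / r^2\<close> times
    \<open>2 y y'\<close>, and \<open>2 |y y'|\<close> is at most \<open>y^2 + y'^2\<close>.\<close>
  have le: "E' r \<le> c / r\<^sup>2 * E r" if r: "r > 0" for r
  proof -
    have "2 * (real n * (real n - 2) / 4) * z r * f r \<le> \<bar>2 * (real n * (real n - 2) / 4) * z r * f r\<bar>"
      by simp
    also have "\<dots> = c * (2 * \<bar>z r\<bar> * \<bar>f r\<bar>)"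
      by (simp add: c_def abs_mult)
    also have "\<dots> \<le> c * ((z r)\<^sup>2 + (f r)\<^sup>2)"
      using sum_squares_bound[of "\<bar>z r\<bar>" "\<bar>f r\<bar>"] by (intro mult_left_mono) (auto simp: c_def)
    finally have "r ^ n * (2 * (real n * (real n - 2) / 4) * z r * f r / r\<^sup>2) \<le> r ^ n * (c * ((z r)\<^sup>2 + (f r)\<^sup>2) / r\<^sup>2)"
      using r by (intro mult_left_mono divide_right_mono) auto
    then show ?thesis by (simp add: E'_def E_def mult_ac)
  qed
  \<comment> \<open>The constant is \<open>G 1\<close>: \<open>G\<close> does not increase from 1 to
    \<open>r\<close>, and \<open>exp (c / r)\<close> is at least 1, so dropping it only lowers the
    value.\<close>
  have "r ^ n * (f r)\<^sup>2 \<le> G 1" if r: "r \<ge> 1" for r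
  proof -
    have "G r \<le> G 1"
    proof (rule DERIV_nonpos_imp_nonincreasing[OF r])
      fix x :: real assume "1 \<le> x" "x \<le> r"
      then show "\<exists>y. (G has_real_derivative y) (at x) \<and> y \<le> 0"
        by (intro exI[of _ "(E' x - c / x\<^sup>2 * E x) * exp (c / x)"] conjI G' mult_nonpos_nonneg) (use le[of x] in auto)
    qed
    moreover have "r ^ n * (f r)\<^sup>2 \<le> E r * 1"
      using r by (simp add: E_def)
    moreover have "E r * 1 \<le> G r"
      unfolding G_def using r by (intro mult_left_mono) (auto simp: E_def c_def)
    ultimately show ?thesis by linarith
  qed
  then show ?thesis using that by blast
qed

text \<open>The profile \<open>f\<close> along one axis \<open>e\<close> satisfies
  \<open>r (f'' + f) = - (d - 1) f'\<close>, where \<open>d\<close> is the dimension, so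
  \<open>bessel_ode_decay\<close> applies with exponent \<open>d - 1\<close>. In dimension one the
  exponent is 0 and the decay is mere boundedness.\<close>

lemma sphere_cos_decay:
  obtains C where "C > 0" "\<And>w :: real^'n. (sphere_cos w)\<^sup>2 \<le> C"
    "\<And>w :: real^'n. norm w ^ (CARD('n) - 1) * (sphere_cos w)\<^sup>2 \<le> C"
proof -
  let ?S = "sphere_measure :: (real^'n) measure"
  define n where "n = CARD('n) - 1"
  define e :: "real^'n" where "e = axis undefined 1"
  have e: "norm e = 1" by (simp add: e_def)
  define f where "f r = (\<integral>\<omega>. cos (r * (\<omega> \<bullet> e)) \<partial>?S)" for r
  define f1 where "f1 r = (\<integral>\<omega>. - ((\<omega> \<bullet> e) * sin (r * (\<omega> \<bullet> e))) \<partial>?S)" for r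
  define f2 where "f2 r = (\<integral>\<omega>. - ((\<omega> \<bullet> e)\<^sup>2 * cos (r * (\<omega> \<bullet> e))) \<partial>?S)" for r
  have f: "(f has_real_derivative f1 r) (at r)" for r
    unfolding f_def f1_def
  proof (rule DERIV_integral_finite_measure[OF finite_measure_sphere, where B = "1 * 1"])
    show "integrable ?S (\<lambda>\<omega>. cos (t * (\<omega> \<bullet> e)))" for t
      by (rule integrable_sphere_bounded[where B = 1])
         measurable
    show "(\<lambda>\<omega>. - ((\<omega> \<bullet> e) * sin (r * (\<omega> \<bullet> e)))) \<in> borel_measurable ?S"
      by (intro borel_measurable_sphere_measure) measurable
    show "((\<lambda>t. cos (t * (\<omega> \<bullet> e))) has_real_derivative - ((\<omega> \<bullet> e) * sin (t * (\<omega> \<bullet> e)))) (at t)" for t \<omega>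
      by (auto intro!: derivative_eq_intros)
    show "\<bar>- ((\<omega> \<bullet> e) * sin (t * (\<omega> \<bullet> e)))\<bar> \<le> 1 * 1" if "\<omega> \<in> space ?S" for t \<omega>
      unfolding abs_minus_cancel using that e by (intro abs_mult_le_mult abs_inner_le_1) auto
  qed
  have f1: "(f1 has_real_derivative f2 r) (at r)" for r
    unfolding f1_def f2_def
  proof (rule DERIV_integral_finite_measure[OF finite_measure_sphere, where B = "(1 * 1) * 1"])
    show "integrable ?S (\<lambda>\<omega>. - ((\<omega> \<bullet> e) * sin (t * (\<omega> \<bullet> e))))" for t
      by (rule integrable_sphere_bounded[where B = "1 * 1"])
         (measurable, unfold real_norm_def abs_minus_cancel, intro abs_mult_le_mult abs_inner_le_1, use e in auto)
    show "(\<lambda>\<omega>. - ((\<omega> \<bullet> e)\<^sup>2 * cos (r * (\<omega> \<bullet> e)))) \<in> borel_measurable ?S"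
      by (intro borel_measurable_sphere_measure) measurable
    show "((\<lambda>t. - ((\<omega> \<bullet> e) * sin (t * (\<omega> \<bullet> e)))) has_real_derivative - ((\<omega> \<bullet> e)\<^sup>2 * cos (t * (\<omega> \<bullet> e)))) (at t)" for t \<omega>
      by (auto intro!: derivative_eq_intros simp: power2_eq_square)
    show "\<bar>- ((\<omega> \<bullet> e)\<^sup>2 * cos (t * (\<omega> \<bullet> e)))\<bar> \<le> (1 * 1) * 1" if "\<omega> \<in> space ?S" for t \<omega>
      unfolding abs_minus_cancel power2_eq_square using that e by (intro abs_mult_le_mult abs_inner_le_1) auto
  qed
  have int: "integrable ?S (\<lambda>\<omega>. (\<omega> \<bullet> b)\<^sup>2 * cos (r * (\<omega> \<bullet> e)))" if "norm b = 1" for b r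
    by (rule integrable_sphere_bounded[where B = "(1 * 1) * 1"])
       (measurable, unfold real_norm_def power2_eq_square, intro abs_mult_le_mult abs_inner_le_1, use e that in auto)
  have int': "integrable ?S (\<lambda>\<omega>. cos (r * (\<omega> \<bullet> e)))" for r
    by (rule integrable_sphere_bounded[where B = 1]) measurable
  have ode: "r * (f2 r + f r) = - real n * f1 r" if r: "r > 0" for r
  proof -
    \<comment> \<open>The axes orthogonal to \<open>e\<close>. The rotation identity holds for each
      of them; summing it uses that the squared coordinates of \<omega> add up to 1.\<close>
    define J where "J = UNIV - {undefined :: 'n}"
    have "real n * - f1 r = (\<Sum>j\<in>J. - f1 r)"
      by (simp add: J_def n_def card_Diff_subset)
    also have "\<dots> = (\<Sum>j\<in>J. r * (\<integral>\<omega>. (\<omega> \<bullet> axis j 1)\<^sup>2 * cos (r * (\<omega> \<bullet> e)) \<partial>?S))"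
    proof (rule sum.cong[OF refl])
      fix j assume "j \<in> J"
      then have "e \<bullet> axis j 1 = 0" by (auto simp: J_def e_def inner_axis_axis)
      then show "- f1 r = r * (\<integral>\<omega>. (\<omega> \<bullet> axis j 1)\<^sup>2 * cos (r * (\<omega> \<bullet> e)) \<partial>?S)"
        using sphere_rotation_identity[OF e _ _ r, of "axis j 1"] by (simp add: f1_def)
    qed
    also have "\<dots> = r * (\<integral>\<omega>. (\<Sum>j\<in>J. (\<omega> \<bullet> axis j 1)\<^sup>2 * cos (r * (\<omega> \<bullet> e))) \<partial>?S)"
      by (subst Bochner_Integration.integral_sum) (auto intro!: int simp: sum_distrib_left)
    also have "(\<integral>\<omega>. (\<Sum>j\<in>J. (\<omega> \<bullet> axis j 1)\<^sup>2 * cos (r * (\<omega> \<bullet> e))) \<partial>?S)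
        = (\<integral>\<omega>. cos (r * (\<omega> \<bullet> e)) - (\<omega> \<bullet> e)\<^sup>2 * cos (r * (\<omega> \<bullet> e)) \<partial>?S)"
    proof (rule Bochner_Integration.integral_cong[OF refl])
      fix \<omega> :: "real^'n" assume "\<omega> \<in> space ?S"
      then have "1 = \<omega> \<bullet> \<omega>" by (simp add: norm_eq_1)
      also have "\<dots> = (\<Sum>j\<in>UNIV. (\<omega> \<bullet> axis j 1)\<^sup>2)"
        by (simp add: inner_axis power2_eq_square) (simp add: inner_vec_def)
      also have "\<dots> = (\<omega> \<bullet> e)\<^sup>2 + (\<Sum>j\<in>J. (\<omega> \<bullet> axis j 1)\<^sup>2)"
        unfolding J_def e_def by (rule sum.remove) auto
      finally have "(\<Sum>j\<in>J. (\<omega> \<bullet> axis j 1)\<^sup>2) = 1 - (\<omega> \<bullet> e)\<^sup>2" by simp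
      then show "(\<Sum>j\<in>J. (\<omega> \<bullet> axis j 1)\<^sup>2 * cos (r * (\<omega> \<bullet> e))) = cos (r * (\<omega> \<bullet> e)) - (\<omega> \<bullet> e)\<^sup>2 * cos (r * (\<omega> \<bullet> e))"
        by (simp add: left_diff_distrib flip: sum_distrib_right)
    qed
    also have "\<dots> = f r + f2 r"
      using int[OF e] int' by (simp add: f_def f2_def)
    finally show ?thesis by simp
  qed
  obtain C where C: "\<And>r. r \<ge> 1 \<Longrightarrow> r ^ n * (f r)\<^sup>2 \<le> C"
    using bessel_ode_decay[of f f1 f2 n] f f1 ode by metis
  have f_eq: "sphere_cos w = f (norm w)" for w :: "real^'n"
  proof -
    have "sphere_cos w = sphere_cos (norm w *\<^sub>R e)"
      by (rule sphere_cos_norm_eq) (simp add: e)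
    then show ?thesis by (simp add: sphere_cos_def f_def)
  qed
  define V where "V = measure ?S (sphere 0 1)"
  have V: "V > 0" unfolding V_def by (rule measure_sphere_pos)
  have "\<bar>f r\<bar> \<le> V" for r
  proof -
    have "\<bar>f r\<bar> \<le> (\<integral>\<omega>. \<bar>cos (r * (\<omega> \<bullet> e))\<bar> \<partial>?S)"
      unfolding f_def by (rule integral_abs_bound)
    also have "\<dots> \<le> (\<integral>\<omega>. 1 \<partial>?S)"
      using int' finite_measure.integrable_const[OF finite_measure_sphere]
      by (intro integral_mono) auto
    finally show ?thesis by (simp add: V_def)
  qed
  then have fV: "(f r)\<^sup>2 \<le> V\<^sup>2" for r
    by (metis abs_ge_zero power2_abs power_mono)
  show ?thesis
  \<comment> \<open>\<open>V^2\<close> bounds the square everywhere, \<open>C\<close> handles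
    arguments of norm at least 1; below norm 1 the power factor is at most 1.\<close>
  proof (rule that[of "max (V\<^sup>2) C"])
    show "max (V\<^sup>2) C > 0" using V by (simp add: less_max_iff_disj)
    show "(sphere_cos w)\<^sup>2 \<le> max (V\<^sup>2) C" for w :: "real^'n"
      using fV[of "norm w"] by (simp add: f_eq le_max_iff_disj)
    show "norm w ^ (CARD('n) - 1) * (sphere_cos w)\<^sup>2 \<le> max (V\<^sup>2) C" for w :: "real^'n"
    proof (cases "norm w \<ge> 1")
      case True
      then show ?thesis using C[of "norm w"] by (simp add: f_eq n_def le_max_iff_disj)
    next
      case False
      then have "norm w ^ (CARD('n) - 1) * (sphere_cos w)\<^sup>2 \<le> 1 * V\<^sup>2"
        using fV[of "norm w"] by (intro mult_mono power_le_one) (auto simp: f_eq)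
      then show ?thesis by simp
    qed
  qed
qed

section \<open>Power integrals and exponents\<close>

lemma ennreal_le_suminf: "f n \<le> (\<Sum>n. f n)" for f :: "nat \<Rightarrow> ennreal"
  using sum_le_suminf[of f "{n}"] by simp

lemma suminf_ennreal_geometric_finite:
  assumes "0 \<le> c" "0 \<le> x" "x < (1::real)"
  shows "(\<Sum>n. ennreal (c * x ^ n)) < \<infinity>"
proof -
  have "summable (\<lambda>n. c * x ^ n)"
    using assms by (intro summable_mult summable_geometric) auto
  then have "(\<Sum>n. ennreal (c * x ^ n)) = ennreal (\<Sum>n. c * x ^ n)"
    using assms by (intro suminf_ennreal_eq summable_sums) auto
  then show ?thesis by simp
qed

text \<open>Dyadic shells: where the norm lies between 2^(-n-1) and 2^(-n) the integrand is at most
  2^((n+1)(d-1)), while the ball of radius 2^(-n) has volume of order 2^(-nd). The products decay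
  like 2^(-n).\<close>

lemma nn_integral_norm_power_ball_finite:
  "(\<integral>\<^sup>+x. inverse (ennreal (norm x ^ (DIM('a) - 1))) * indicator (cball 0 1) x \<partial>(lborel :: 'a::euclidean_space measure)) < \<infinity>"
proof -
  let ?d = "DIM('a)"
  let ?V = "unit_ball_vol (real ?d)"
  let ?f = "\<lambda>n x::'a. ennreal (2 ^ (Suc n * (?d - 1))) * indicator (cball 0 ((1/2) ^ n)) x"
  have pointwise: "inverse (ennreal (norm x ^ (?d - 1))) * indicator (cball 0 1) x \<le> (\<Sum>n. ?f n x)"
    if x: "x \<noteq> 0" for x :: 'a
  proof (cases "norm x \<le> 1")
    case True
    obtain n0 where "(1/2) ^ n0 < norm x"
      using real_arch_pow_inv[of "norm x" "1/2"] x by auto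
    moreover have "(0::real) < (1/2) ^ n0" by simp
    ultimately have "(1/2) ^ Suc n0 < norm x" unfolding power_Suc by linarith
    \<comment> \<open>Minimality of \<open>n\<close> gives the other side of the shell,
      \<open>norm x \<le> (1/2) ^ n\<close>; for \<open>n = 0\<close> this is the case
      assumption.\<close>
    then obtain n where n: "(1/2) ^ Suc n < norm x" and least: "\<And>j. j < n \<Longrightarrow> \<not> (1/2) ^ Suc j < norm x"
      using exists_least_iff[of "\<lambda>n. (1/2) ^ Suc n < norm x"] by blast
    have le: "norm x \<le> (1/2) ^ n"
      using True least[of "n - 1"] by (cases n) auto
    have "inverse (norm x ^ (?d - 1)) \<le> inverse (((1/2) ^ Suc n) ^ (?d - 1))"
      using n by (intro le_imp_inverse_le power_mono) auto
    also have "\<dots> = 2 ^ (Suc n * (?d - 1))"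
      by (simp add: power_one_over del: power_Suc mult_Suc flip: power_mult)
    finally have "inverse (ennreal (norm x ^ (?d - 1))) \<le> ennreal (2 ^ (Suc n * (?d - 1)))"
      using x by (simp add: inverse_ennreal ennreal_leI)
    then have "inverse (ennreal (norm x ^ (?d - 1))) * indicator (cball 0 1) x \<le> ?f n x"
      using True le by simp
    also have "\<dots> \<le> (\<Sum>n. ?f n x)"
      by (rule ennreal_le_suminf)
    finally show ?thesis .
  qed simp
  \<comment> \<open>At the origin the integrand may be infinite, but a single point is a null
    set.\<close>
  have "AE x in lborel. x \<noteq> (0::'a)"
    by (rule AE_lborel_singleton)
  then have "(\<integral>\<^sup>+x. inverse (ennreal (norm x ^ (?d - 1))) * indicator (cball 0 1) x \<partial>(lborel :: 'a measure))
      \<le> (\<integral>\<^sup>+x. (\<Sum>n. ?f n x) \<partial>lborel)"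
    by (intro nn_integral_mono_AE, eventually_elim) (rule pointwise)
  also have "\<dots> = (\<Sum>n. \<integral>\<^sup>+x. ?f n x \<partial>lborel)"
    by (rule nn_integral_suminf) (intro borel_measurable_times_ennreal borel_measurable_indicator, auto)
  also have "\<dots> = (\<Sum>n. ennreal (?V * 2 ^ (?d - 1) * (1/2) ^ n))"
  proof (rule suminf_cong)
    fix n
    have "((1/2) ^ n) ^ ?d = (1/2) ^ n * ((1/2 :: real) ^ n) ^ (?d - 1)"
      by (simp flip: power_Suc)
    moreover have "(2::real) ^ (Suc n * (?d - 1)) = 2 ^ (?d - 1) * (2 ^ n) ^ (?d - 1)"
      by (simp only: mult_Suc power_add power_mult)
    moreover have "(2 ^ n) ^ (?d - 1) * ((1/2 :: real) ^ n) ^ (?d - 1) = 1"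
      by (simp add: power_one_over)
    ultimately have "(2::real) ^ (Suc n * (?d - 1)) * (?V * ((1/2) ^ n) ^ ?d) = ?V * 2 ^ (?d - 1) * (1/2) ^ n"
      by simp
    then show "(\<integral>\<^sup>+x. ?f n x \<partial>lborel) = ennreal (?V * 2 ^ (?d - 1) * (1/2) ^ n)"
      by (subst nn_integral_cmult_indicator) (simp_all add: emeasure_cball flip: ennreal_mult)
  qed
  also have "\<dots> < \<infinity>"
    by (rule suminf_ennreal_geometric_finite) auto
  finally show ?thesis .
qed

text \<open>The same decomposition outward: the shell of radius about 2^n contributes at most a
  constant times 2^(n(d-s)), a convergent series because \<open>s\<close> exceeds the dimension
  d.\<close>

lemma nn_integral_norm_powr_outside_ball_finite:
  assumes s: "s > real DIM('a::euclidean_space)"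
  shows "(\<integral>\<^sup>+x. ennreal (norm x powr (- s)) * indicator {x. norm x \<ge> 1} x \<partial>(lborel :: 'a measure)) < \<infinity>"
proof -
  let ?d = "DIM('a)"
  let ?V = "unit_ball_vol (real ?d)"
  let ?f = "\<lambda>n x::'a. ennreal ((2 powr (- s)) ^ n) * indicator (cball 0 (2 ^ Suc n)) x"
  have pointwise: "ennreal (norm x powr (- s)) * indicator {x. norm x \<ge> 1} x \<le> (\<Sum>n. ?f n x)" for x :: 'a
  proof (cases "norm x \<ge> 1")
    case True
    obtain n0 :: nat where "norm x < 2 ^ n0"
      using real_arch_pow[of 2 "norm x"] by auto
    moreover have "0 < (2::real) ^ n0" by simp
    ultimately have "norm x < 2 ^ Suc n0" unfolding power_Suc by linarith
    then obtain n where n: "norm x < 2 ^ Suc n" and least: "\<And>j. j < n \<Longrightarrow> \<not> norm x < 2 ^ Suc j"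
      using exists_least_iff[of "\<lambda>n. norm x < 2 ^ Suc n"] by blast
    have le: "2 ^ n \<le> norm x"
      using True least[of "n - 1"] by (cases n) auto
    have "norm x powr (- s) \<le> (2 ^ n) powr (- s)"
      using s le by (intro powr_mono2') auto
    also have "\<dots> = (2 powr (- s)) ^ n"
      by (simp add: powr_powr mult.commute flip: powr_realpow)
    finally have "ennreal (norm x powr (- s)) * indicator {x. norm x \<ge> 1} x \<le> ?f n x"
      using True n by (simp add: ennreal_leI)
    also have "\<dots> \<le> (\<Sum>n. ?f n x)"
      by (rule ennreal_le_suminf)
    finally show ?thesis .
  qed simp
  have "(\<integral>\<^sup>+x. ennreal (norm x powr (- s)) * indicator {x. norm x \<ge> 1} x \<partial>(lborel :: 'a measure))
      \<le> (\<integral>\<^sup>+x. (\<Sum>n. ?f n x) \<partial>lborel)"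
    by (intro nn_integral_mono pointwise)
  also have "\<dots> = (\<Sum>n. \<integral>\<^sup>+x. ?f n x \<partial>lborel)"
    by (rule nn_integral_suminf) (intro borel_measurable_times_ennreal borel_measurable_indicator, auto)
  also have "\<dots> = (\<Sum>n. ennreal (?V * 2 ^ ?d * (2 powr (real ?d - s)) ^ n))"
  proof (rule suminf_cong)
    fix n
    have "2 powr (real ?d - s) = 2 powr (- s) * 2 ^ ?d"
      using powr_add[of 2 "- s" "real ?d"] by (simp add: powr_realpow)
    moreover have "((2::real) ^ Suc n) ^ ?d = (2 ^ ?d) ^ Suc n"
      by (simp only: mult.commute flip: power_mult)
    ultimately have "(2 powr (- s)) ^ n * (?V * (2 ^ Suc n) ^ ?d) = ?V * 2 ^ ?d * (2 powr (real ?d - s)) ^ n"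
      by (simp only: power_Suc power_mult_distrib mult_ac)
    then show "(\<integral>\<^sup>+x. ?f n x \<partial>lborel) = ennreal (?V * 2 ^ ?d * (2 powr (real ?d - s)) ^ n)"
      by (subst nn_integral_cmult_indicator) (simp_all add: emeasure_cball del: power_Suc flip: ennreal_mult)
  qed
  also have "\<dots> < \<infinity>"
    using s by (intro suminf_ennreal_geometric_finite) (auto simp: powr_less_one)
  finally show ?thesis .
qed

text \<open>For fixed \<open>x\<close> the slice in \<open>y\<close> is a ball of radius
  \<open>A * norm x powr (- \<beta>)\<close>, whose volume adds \<beta> times the dimension of
  \<open>y\<close> to the decay exponent. The hypothesis puts the total exponent above the dimension
  of \<open>x\<close>.\<close>

lemma nn_integral_horn_finite:
  fixes A \<beta> t :: real
  assumes A: "A \<ge> 0" and t: "t + \<beta> * real DIM('b::euclidean_space) > real DIM('a::euclidean_space)"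
  shows "(\<integral>\<^sup>+x. \<integral>\<^sup>+y. ennreal (norm x powr (- t)) *
      indicator {(x, y). norm x \<ge> 1 \<and> norm y \<le> A * norm x powr (- \<beta>)} (x, y) \<partial>(lborel :: 'b measure) \<partial>(lborel :: 'a measure)) < \<infinity>"
proof -
  let ?V = "unit_ball_vol (real DIM('b)) * A ^ DIM('b)"
  have "(\<integral>\<^sup>+y. ennreal (norm x powr (- t)) *
      indicator {(x, y). norm x \<ge> 1 \<and> norm y \<le> A * norm x powr (- \<beta>)} (x, y) \<partial>(lborel :: 'b measure))
    = ennreal ?V * (ennreal (norm x powr (- (t + \<beta> * real DIM('b)))) * indicator {x. norm x \<ge> 1} x)" for x :: 'a
  proof (cases "norm x \<ge> 1")
    case True
    then have x: "norm x > 0" by linarith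
    have "(\<integral>\<^sup>+y. ennreal (norm x powr (- t)) *
        indicator {(x, y). norm x \<ge> 1 \<and> norm y \<le> A * norm x powr (- \<beta>)} (x, y) \<partial>(lborel :: 'b measure))
      = (\<integral>\<^sup>+y. ennreal (norm x powr (- t)) * indicator (cball 0 (A * norm x powr (- \<beta>))) y \<partial>(lborel :: 'b measure))"
      using True by (intro nn_integral_cong) (auto simp: indicator_def)
    also have "\<dots> = ennreal (norm x powr (- t) * (unit_ball_vol (real DIM('b)) * (A * norm x powr (- \<beta>)) ^ DIM('b)))"
      using A by (subst nn_integral_cmult_indicator) (simp_all add: emeasure_cball flip: ennreal_mult)
    also have "norm x powr (- t) * (unit_ball_vol (real DIM('b)) * (A * norm x powr (- \<beta>)) ^ DIM('b))
       = ?V * norm x powr (- (t + \<beta> * real DIM('b)))"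
    proof -
      have "(norm x powr (- \<beta>)) ^ DIM('b) = norm x powr (- \<beta> * real DIM('b))"
        using x by (simp add: powr_powr flip: powr_realpow)
      moreover have "norm x powr (- t) * norm x powr (- \<beta> * real DIM('b)) = norm x powr (- (t + \<beta> * real DIM('b)))"
        by (simp flip: powr_add)
      ultimately show ?thesis
        by (simp only: power_mult_distrib mult_ac)
    qed
    finally show ?thesis
      using True A by (simp add: ennreal_mult)
  qed (simp add: indicator_def)
  then have "(\<integral>\<^sup>+x. \<integral>\<^sup>+y. ennreal (norm x powr (- t)) *
      indicator {(x, y). norm x \<ge> 1 \<and> norm y \<le> A * norm x powr (- \<beta>)} (x, y) \<partial>(lborel :: 'b measure) \<partial>(lborel :: 'a measure))
     = ennreal ?V * (\<integral>\<^sup>+x. ennreal (norm x powr (- (t + \<beta> * real DIM('b)))) * indicator {x. norm x \<ge> 1} x \<partial>(lborel :: 'a measure))"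
    by (simp add: nn_integral_cmult)
  also have "\<dots> < \<infinity>"
    using nn_integral_norm_powr_outside_ball_finite[OF t] by (simp add: ennreal_mult_less_top)
  finally show ?thesis .
qed

text \<open>The first inequality governs the end of the region where |u| is large, the second the
  end where |v| is large. Each comes from an entry of \<open>lambda_Nk\<close> by clearing the
  denominator. If m = 1 (or k = 1), the \<open>q\<close> term of the first (or second) vanishes and
  the inequality is exactly the extra restriction on \<alpha>.\<close>

lemma lambda_Nk_exponents:
  fixes \<alpha> q :: real and m k :: nat
  assumes mk: "m \<ge> 1" "k \<ge> 1" "m + k \<ge> 3" and \<alpha>: "\<alpha> > 0"
    and k1: "k = 1 \<Longrightarrow> \<alpha> > 1 / (real (m + k) - 1)"
    and m1: "k = m + k - 1 \<Longrightarrow> \<alpha> < real (m + k) - 1"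
    and q: "q > lambda_Nk (m + k) k \<alpha>"
  shows "(real m - 1) * (q / 2) + 1 / \<alpha> * real k > real m"
    and "(real k - 1) * (q / 2) + \<alpha> * real m > real k"
proof -
  have *: "(real m - 1) * (q / 2) + 1 / \<alpha> * real k > real m"
    if "q > (2 * real m - 2 * real k / \<alpha>) / (real m - 1)" "m > 1"
    using that \<alpha> by (simp add: field_simps)
  have **: "(real k - 1) * (q / 2) + \<alpha> * real m > real k"
    if "q > (2 * real k - 2 * \<alpha> * real m) / (real k - 1)" "k > 1"
    using that \<alpha> by (simp add: field_simps)
  have m_eq: "k = m + k - Suc 0 \<longleftrightarrow> m = 1"
    using mk by auto
  show "(real m - 1) * (q / 2) + 1 / \<alpha> * real k > real m"
  proof (cases "m = 1")
    case True
    then show ?thesis using m1 \<alpha> by (simp add: field_simps)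
  next
    case False
    then show ?thesis
      using q mk by (intro *) (auto simp: lambda_Nk_def m_eq split: if_splits)
  qed
  show "(real k - 1) * (q / 2) + \<alpha> * real m > real k"
  proof (cases "k = 1")
    case True
    then show ?thesis using k1 mk by (simp add: field_simps)
  next
    case False
    then show ?thesis
      using q mk by (intro **) (auto simp: lambda_Nk_def m_eq split: if_splits)
  qed
qed

section \<open>Averaging over block rotations\<close>

lemma borel_measurable_cis [measurable]: "cis \<in> borel_measurable borel"
  by (intro borel_measurable_continuous_onI continuous_intros)

lemma borel_measurable_sphere_ident:
  "(\<lambda>x. x) \<in> borel_measurable (sphere_measure :: 'a::euclidean_space measure)"
  by (rule borel_measurable_sphere_measure) simp

text \<open>The antipodal map is orthogonal and sine is odd, so the imaginary part integrates to
  0.\<close>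

lemma integral_sphere_cis:
  fixes w :: "real^'n"
  shows "(\<integral>p. cis (w \<bullet> p) \<partial>sphere_measure) = complex_of_real (sphere_cos w)"
proof -
  let ?S = "sphere_measure :: (real^'n) measure"
  have "(\<integral>p. sin (w \<bullet> (- p)) \<partial>?S) = (\<integral>p. sin (w \<bullet> p) \<partial>?S)"
    by (rule integral_sphere_orthogonal)
       (simp add: orthogonal_transformation_def linear_iff, intro borel_measurable_sphere_measure, measurable)
  then have "(\<integral>p. sin (w \<bullet> p) \<partial>?S) = 0"
    by simp
  moreover have "(\<integral>p. cis (w \<bullet> p) \<partial>?S) =
      (\<integral>p. complex_of_real (cos (w \<bullet> p)) + \<i> * complex_of_real (sin (w \<bullet> p)) \<partial>?S)"
    by (intro Bochner_Integration.integral_cong) (auto simp: complex_eq_iff)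
  moreover have "integrable ?S (\<lambda>p. cos (w \<bullet> p))" "integrable ?S (\<lambda>p. sin (w \<bullet> p))"
    by (rule integrable_sphere_bounded[where B = 1]; measurable)+
  ultimately show ?thesis
    by (simp add: sphere_cos_def inner_commute)
qed

text \<open>Fubini, with the unimodular factor \<open>cis\<close> against an integrable \<Phi>. The
  map \<open>L\<close> is kept general so that each block can be averaged in turn, the factor of the
  other block being absorbed into \<Phi>.\<close>

lemma sphere_average_cis:
  fixes L :: "'a::euclidean_space \<Rightarrow> real^'n" and \<Phi> :: "'a \<Rightarrow> complex"
  assumes L: "L \<in> borel_measurable borel" and \<Phi>: "integrable sphere_measure \<Phi>"
  shows "(\<integral>p. \<integral>\<omega>. cis (L \<omega> \<bullet> p) * \<Phi> \<omega> \<partial>sphere_measure \<partial>sphere_measure) =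
    (\<integral>\<omega>. complex_of_real (sphere_cos (L \<omega>)) * \<Phi> \<omega> \<partial>sphere_measure)"
proof -
  let ?M = "sphere_measure :: (real^'n) measure" and ?N = "sphere_measure :: 'a measure"
  interpret M: finite_measure ?M by (rule finite_measure_sphere)
  interpret N: finite_measure ?N by (rule finite_measure_sphere)
  interpret pair_sigma_finite ?M ?N ..
  have [measurable]: "\<Phi> \<in> borel_measurable ?N"
    using \<Phi> by (rule borel_measurable_integrable)
  have [measurable]: "L \<in> borel_measurable ?N"
    by (rule borel_measurable_sphere_measure[OF L])
  have meas: "(\<lambda>(p, \<omega>). cis (L \<omega> \<bullet> p) * \<Phi> \<omega>) \<in> borel_measurable (?M \<Otimes>\<^sub>M ?N)"
  proof -
    have 1: "(\<lambda>z. fst z) \<in> borel_measurable (?M \<Otimes>\<^sub>M ?N)"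
      by (rule measurable_compose[OF measurable_fst borel_measurable_sphere_ident])
    have 2: "(\<lambda>z. L (snd z)) \<in> borel_measurable (?M \<Otimes>\<^sub>M ?N)"
      by measurable
    have "(\<lambda>z. cis (L (snd z) \<bullet> fst z)) \<in> borel_measurable (?M \<Otimes>\<^sub>M ?N)"
      using borel_measurable_inner[OF 2 1] by (rule measurable_compose[OF _ borel_measurable_cis])
    then show ?thesis
      by (simp add: case_prod_beta)
  qed
  have int: "integrable ?N (\<lambda>\<omega>. cis (L \<omega> \<bullet> p) * \<Phi> \<omega>)" for p
    by (rule Bochner_Integration.integrable_bound[OF \<Phi>]) (auto simp: norm_mult)
  have "integrable (?M \<Otimes>\<^sub>M ?N) (\<lambda>(p, \<omega>). cis (L \<omega> \<bullet> p) * \<Phi> \<omega>)"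
    by (rule Fubini_integrable[OF meas]) (auto simp: norm_mult int)
  then have "(\<integral>p. \<integral>\<omega>. cis (L \<omega> \<bullet> p) * \<Phi> \<omega> \<partial>?N \<partial>?M) = (\<integral>\<omega>. \<integral>p. cis (L \<omega> \<bullet> p) * \<Phi> \<omega> \<partial>?M \<partial>?N)"
    by (rule Fubini_integral[symmetric])
  also have "\<dots> = (\<integral>\<omega>. complex_of_real (sphere_cos (L \<omega>)) * \<Phi> \<omega> \<partial>?N)"
    by (simp add: integral_sphere_cis)
  finally show ?thesis .
qed

lemma sphere_cos_measurable [measurable]: "(sphere_cos :: real^'n \<Rightarrow> real) \<in> borel_measurable borel"
proof -
  interpret finite_measure "sphere_measure :: (real^'n) measure" by (rule finite_measure_sphere)
  have "(\<lambda>z. fst z) \<in> borel_measurable (borel \<Otimes>\<^sub>M (sphere_measure :: (real^'n) measure))"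
    "(\<lambda>z. snd z) \<in> borel_measurable (borel \<Otimes>\<^sub>M (sphere_measure :: (real^'n) measure))"
    by (simp, rule measurable_compose[OF measurable_snd borel_measurable_sphere_ident])
  then have "(\<lambda>z. cos (snd z \<bullet> fst z)) \<in> borel_measurable (borel \<Otimes>\<^sub>M (sphere_measure :: (real^'n) measure))"
    by measurable
  then show ?thesis
    unfolding sphere_cos_def[abs_def]
    by (intro borel_measurable_lebesgue_integral) (simp add: case_prod_beta)
qed

text \<open>The unnormalised \<open>ext_sigma\<close>; the power of \<open>2 * pi\<close> returns
  only in the final estimate.\<close>

definition sphere_fourier :: "('a::euclidean_space \<Rightarrow> complex) \<Rightarrow> 'a \<Rightarrow> complex" where
  "sphere_fourier F x = (\<integral>\<omega>. cis (\<omega> \<bullet> x) * F \<omega> \<partial>sphere_measure)"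

lemma orthogonal_transformation_Pair:
  fixes A :: "'a::euclidean_space \<Rightarrow> 'a" and B :: "'b::euclidean_space \<Rightarrow> 'b"
  assumes "orthogonal_transformation A" "orthogonal_transformation B"
  shows "orthogonal_transformation (\<lambda>(u, v). (A u, B v))"
  using assms by (auto simp: orthogonal_transformation_def linear_iff)

text \<open>Change variables by the block rotation: it preserves surface measure and inner products,
  and \<open>F\<close> absorbs it by invariance.\<close>

lemma sphere_fourier_Gk_invariant:
  fixes F :: "(real^'m) \<times> (real^'k) \<Rightarrow> complex"
  assumes F: "F \<in> borel_measurable sphere_measure" "G_invariant Gk F"
    and AB: "orthogonal_transformation A" "orthogonal_transformation B"
  shows "sphere_fourier F (A u, B v) = sphere_fourier F (u, v)"
proof -
  let ?T = "\<lambda>(u, v). (A u, B v)"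
  let ?S = "sphere_measure :: ((real^'m) \<times> (real^'k)) measure"
  have T: "orthogonal_transformation ?T"
    by (rule orthogonal_transformation_Pair[OF AB])
  have FT: "F (?T \<omega>) = F \<omega>" if "\<omega> \<in> sphere 0 1" for \<omega>
  proof -
    have "?T \<in> Gk"
      using AB unfolding Gk_def by blast
    then show ?thesis
      using F(2) that unfolding G_invariant_def by blast
  qed
  have "sphere_fourier F (?T (u, v)) = (\<integral>\<omega>. cis (?T \<omega> \<bullet> ?T (u, v)) * F (?T \<omega>) \<partial>?S)"
    unfolding sphere_fourier_def
    by (rule integral_sphere_orthogonal[OF T, symmetric])
       (intro borel_measurable_times F borel_measurable_sphere_measure, measurable)
  also have "\<dots> = sphere_fourier F (u, v)"
    unfolding sphere_fourier_def
    using T FT by (intro Bochner_Integration.integral_cong) (auto simp: orthogonal_transformation_def)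
  finally show ?thesis by simp
qed

text \<open>Orthogonal maps act transitively on vectors of equal norm, in each block
  separately.\<close>

lemma sphere_fourier_norm_eq:
  fixes F :: "(real^'m) \<times> (real^'k) \<Rightarrow> complex"
  assumes F: "F \<in> borel_measurable sphere_measure" "G_invariant Gk F"
    and "norm u' = norm u" "norm v' = norm v"
  shows "sphere_fourier F (u', v') = sphere_fourier F (u, v)"
proof -
  obtain A B where "orthogonal_transformation A" "A u = u'" "orthogonal_transformation B" "B v = v'"
    using orthogonal_transformation_exists[of u u'] orthogonal_transformation_exists[of v v'] assms
    by metis
  then show ?thesis using sphere_fourier_Gk_invariant[OF F] by metis
qed

text \<open>The left side is a constant integrated over unit vectors \<open>p\<close> and
  \<open>q\<close>; the total masses appear because the surface measures are not normalised.
  Replacing the value at \<open>(u, v)\<close> by the one at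
  \<open>(norm u *\<^sub>R p, norm v *\<^sub>R q)\<close> lets both averages be carried out.\<close>

lemma sphere_fourier_averaged:
  fixes F :: "(real^'m) \<times> (real^'k) \<Rightarrow> complex"
  assumes F: "integrable sphere_measure F" "G_invariant Gk F"
  shows "complex_of_real (measure (sphere_measure :: (real^'m) measure) (sphere 0 1) *
      measure (sphere_measure :: (real^'k) measure) (sphere 0 1)) * sphere_fourier F (u, v) =
    (\<integral>\<omega>. complex_of_real (sphere_cos (norm v *\<^sub>R snd \<omega>) * sphere_cos (norm u *\<^sub>R fst \<omega>)) * F \<omega> \<partial>sphere_measure)"
proof -
  let ?M = "sphere_measure :: (real^'m) measure" and ?K = "sphere_measure :: (real^'k) measure"
  let ?S = "sphere_measure :: ((real^'m) \<times> (real^'k)) measure"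
  have F_meas [measurable]: "F \<in> borel_measurable ?S"
    using F(1) by (rule borel_measurable_integrable)
  obtain C where C: "C > 0" "\<And>w :: real^'m. (sphere_cos w)\<^sup>2 \<le> C"
    using sphere_cos_decay by metis
  have L: "(\<lambda>\<omega>. norm u *\<^sub>R fst \<omega>) \<in> borel_measurable (borel :: ((real^'m) \<times> (real^'k)) measure)"
    "(\<lambda>\<omega>. norm v *\<^sub>R snd \<omega>) \<in> borel_measurable (borel :: ((real^'m) \<times> (real^'k)) measure)"
    by (intro borel_measurable_continuous_onI continuous_intros)+
  have meas1: "(\<lambda>\<omega>. cis ((norm v *\<^sub>R snd \<omega>) \<bullet> q)) \<in> borel_measurable ?S" for q
    by (rule borel_measurable_sphere_measure, rule measurable_compose[OF _ borel_measurable_cis])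
       (intro borel_measurable_inner L borel_measurable_const)
  have meas2: "(\<lambda>\<omega>. complex_of_real (sphere_cos (norm u *\<^sub>R fst \<omega>))) \<in> borel_measurable ?S"
    by (rule borel_measurable_sphere_measure, rule measurable_compose[OF measurable_compose[OF L(1) sphere_cos_measurable]])
       (rule borel_measurable_of_real)
  have int1: "integrable ?S (\<lambda>\<omega>. cis ((norm v *\<^sub>R snd \<omega>) \<bullet> q) * F \<omega>)" for q
    using meas1 by (intro Bochner_Integration.integrable_bound[OF F(1)]) (auto simp: norm_mult)
  \<comment> \<open>This serves the second average, where the bounded \<open>sphere_cos\<close>
    factor from the first has joined \<open>F\<close>.\<close>
  have int2: "integrable ?S (\<lambda>\<omega>. complex_of_real (sphere_cos (norm u *\<^sub>R fst \<omega>)) * F \<omega>)"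
  proof (rule Bochner_Integration.integrable_bound)
    show "integrable ?S (\<lambda>\<omega>. complex_of_real (sqrt C) * F \<omega>)"
      using F(1) by simp
    show "AE \<omega> in ?S. norm (complex_of_real (sphere_cos (norm u *\<^sub>R fst \<omega>)) * F \<omega>) \<le> norm (complex_of_real (sqrt C) * F \<omega>)"
      using C by (auto simp: norm_mult intro!: mult_right_mono real_le_rsqrt)
  qed (use meas2 in measurable)
  have "complex_of_real (measure ?M (sphere 0 1) * measure ?K (sphere 0 1)) * sphere_fourier F (u, v) =
      (\<integral>q. \<integral>p. sphere_fourier F (u, v) \<partial>?M \<partial>?K)"
    by (simp add: scaleR_conv_of_real mult_ac)
  also have "\<dots> = (\<integral>q. \<integral>p. \<integral>\<omega>. cis ((norm u *\<^sub>R fst \<omega>) \<bullet> p) * (cis ((norm v *\<^sub>R snd \<omega>) \<bullet> q) * F \<omega>) \<partial>?S \<partial>?M \<partial>?K)"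
  proof (intro Bochner_Integration.integral_cong refl)
    fix p :: "real^'m" and q :: "real^'k" assume "q \<in> space ?K" "p \<in> space ?M"
    then have "sphere_fourier F (u, v) = sphere_fourier F (norm u *\<^sub>R p, norm v *\<^sub>R q)"
      using F by (intro sphere_fourier_norm_eq) auto
    then show "sphere_fourier F (u, v) =
        (\<integral>\<omega>. cis ((norm u *\<^sub>R fst \<omega>) \<bullet> p) * (cis ((norm v *\<^sub>R snd \<omega>) \<bullet> q) * F \<omega>) \<partial>?S)"
      by (simp add: sphere_fourier_def inner_prod_def cis_mult mult.assoc[symmetric])
  qed
  also have "\<dots> = (\<integral>q. \<integral>\<omega>. complex_of_real (sphere_cos (norm u *\<^sub>R fst \<omega>)) * (cis ((norm v *\<^sub>R snd \<omega>) \<bullet> q) * F \<omega>) \<partial>?S \<partial>?K)"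
    by (simp only: sphere_average_cis[OF L(1) int1])
  also have "\<dots> = (\<integral>q. \<integral>\<omega>. cis ((norm v *\<^sub>R snd \<omega>) \<bullet> q) * (complex_of_real (sphere_cos (norm u *\<^sub>R fst \<omega>)) * F \<omega>) \<partial>?S \<partial>?K)"
    by (simp only: mult.left_commute)
  also have "\<dots> = (\<integral>\<omega>. complex_of_real (sphere_cos (norm v *\<^sub>R snd \<omega>)) * (complex_of_real (sphere_cos (norm u *\<^sub>R fst \<omega>)) * F \<omega>) \<partial>?S)"
    by (rule sphere_average_cis[OF L(2) int2])
  finally show ?thesis by (simp add: mult.assoc)
qed

section \<open>The pointwise bound and its integral\<close>

text \<open>Valued in \<open>ennreal\<close> so that in dimension at least two it is infinite at the
  origin, where a bound by a positive multiple of it is trivial. In dimension one the exponent is 0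
  and the kernel is constantly 1.\<close>

definition norm_kernel :: "'a::euclidean_space \<Rightarrow> ennreal" where
  "norm_kernel x = inverse (ennreal (norm x ^ (DIM('a) - 1)))"

lemma norm_kernel_measurable [measurable]: "norm_kernel \<in> borel_measurable borel"
  unfolding norm_kernel_def[abs_def] by measurable

lemma norm_kernel_antimono:
  fixes x y :: "'a::euclidean_space"
  assumes "norm x \<le> norm y"
  shows "norm_kernel y \<le> norm_kernel x"
proof (cases "norm x ^ (DIM('a) - 1) = 0")
  case True
  then show ?thesis by (simp add: norm_kernel_def del: power_eq_0_iff)
next
  case False
  moreover have "norm x ^ (DIM('a) - 1) \<ge> 0" by simp
  ultimately have "norm x ^ (DIM('a) - 1) > 0" by linarith
  moreover from this have "norm x ^ (DIM('a) - 1) \<le> norm y ^ (DIM('a) - 1)"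
    using assms by (intro power_mono) auto
  ultimately show ?thesis
    by (auto simp: norm_kernel_def inverse_ennreal intro!: ennreal_leI le_imp_inverse_le)
qed

text \<open>Over the punctured ball the kernels are taken at x/|x|, whose components are at least as
  long as those of x since |x| < 1; hence the kernels at x dominate. Enlarging the ball to a product
  of balls separates the variables.\<close>

lemma nn_integral_sphere_norm_kernels_finite:
  "(\<integral>\<^sup>+\<omega>. norm_kernel (fst \<omega>) * norm_kernel (snd \<omega>)
      \<partial>(sphere_measure :: ('a::euclidean_space \<times> 'b::euclidean_space) measure)) < \<infinity>"
proof -
  let ?f = "\<lambda>x::'a. norm_kernel x * indicator (cball 0 1) x"
  let ?g = "\<lambda>x::'b. norm_kernel x * indicator (cball 0 1) x"
  have B: "cball 0 1 \<in> sets (borel :: 'a measure)" "cball 0 1 \<in> sets (borel :: 'b measure)"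
    by auto
  have f [measurable]: "?f \<in> borel_measurable borel"
    by (intro borel_measurable_times_ennreal borel_measurable_indicator norm_kernel_measurable B)
  have g [measurable]: "?g \<in> borel_measurable borel"
    by (intro borel_measurable_times_ennreal borel_measurable_indicator norm_kernel_measurable B)
  have fst_snd: "fst \<in> borel_measurable (borel :: ('a \<times> 'b) measure)" "snd \<in> borel_measurable (borel :: ('a \<times> 'b) measure)"
    by (intro borel_measurable_continuous_onI continuous_intros)+
  have "(\<integral>\<^sup>+\<omega>. norm_kernel (fst \<omega>) * norm_kernel (snd \<omega>) \<partial>(sphere_measure :: ('a \<times> 'b) measure))
      = ennreal (real DIM('a \<times> 'b)) * (\<integral>\<^sup>+x. norm_kernel (fst (x /\<^sub>R norm x)) * norm_kernel (snd (x /\<^sub>R norm x)) *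
         indicator (ball 0 1 - {0}) x \<partial>(lborel :: ('a \<times> 'b) measure))"
    by (intro nn_integral_sphere_measure borel_measurable_sphere_measure borel_measurable_times_ennreal
          measurable_compose[OF _ norm_kernel_measurable] fst_snd)
  also have "\<dots> \<le> ennreal (real DIM('a \<times> 'b)) * (\<integral>\<^sup>+x. ?f (fst x) * ?g (snd x) \<partial>(lborel :: ('a \<times> 'b) measure))"
  proof (intro mult_left_mono nn_integral_mono)
    fix x :: "'a \<times> 'b"
    show "norm_kernel (fst (x /\<^sub>R norm x)) * norm_kernel (snd (x /\<^sub>R norm x)) *
         indicator (ball 0 1 - {0}) x \<le> ?f (fst x) * ?g (snd x)"
    proof (cases "x \<in> ball 0 1 - {0}")
      case True
      then have x: "norm x > 0" "norm x < 1" by auto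
      have le: "norm (fst x) \<le> norm x" "norm (snd x) \<le> norm x"
        using norm_fst_le[of "fst x" "snd x"] norm_snd_le[of "snd x" "fst x"] by simp_all
      have "norm (fst x) \<le> norm (fst (x /\<^sub>R norm x))" "norm (snd x) \<le> norm (snd (x /\<^sub>R norm x))"
        using x by (auto simp: le_divide_eq mult_left_le divide_inverse[symmetric] mult.commute[of "inverse _"])
      then have "norm_kernel (fst (x /\<^sub>R norm x)) * norm_kernel (snd (x /\<^sub>R norm x))
          \<le> norm_kernel (fst x) * norm_kernel (snd x)"
        by (intro mult_mono norm_kernel_antimono) auto
      then show ?thesis using True x le by simp
    qed simp
  qed simp
  also have "(\<integral>\<^sup>+x. ?f (fst x) * ?g (snd x) \<partial>(lborel :: ('a \<times> 'b) measure)) = (\<integral>\<^sup>+x. \<integral>\<^sup>+y. ?f x * ?g y \<partial>lborel \<partial>lborel)"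
  proof -
    have "(\<lambda>x. ?f (fst x) * ?g (snd x)) \<in> borel_measurable (lborel \<Otimes>\<^sub>M lborel)"
      using measurable_compose[OF fst_snd(1) f] measurable_compose[OF fst_snd(2) g]
      by (simp add: lborel_prod)
    from lborel.nn_integral_fst[OF this] show ?thesis
      by (simp add: lborel_prod)
  qed
  also have "\<dots> = (\<integral>\<^sup>+x. ?f x \<partial>lborel) * (\<integral>\<^sup>+y. ?g y \<partial>lborel)"
    using f g by (simp add: nn_integral_cmult nn_integral_multc)
  also have "ennreal (real DIM('a \<times> 'b)) * \<dots> < \<infinity>"
    using nn_integral_norm_power_ball_finite[where 'a='a] nn_integral_norm_power_ball_finite[where 'a='b]
    by (simp add: norm_kernel_def ennreal_mult_less_top)
  finally show ?thesis .
qed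

text \<open>The decay rate of the square of \<open>sphere_cos\<close>, which is why square roots and
  the exponent \<open>q / 2\<close> appear below. The maximum with 1 covers small arguments.\<close>

definition decay_weight :: "'a::euclidean_space \<Rightarrow> real" where
  "decay_weight u = inverse (max 1 (norm u) ^ (DIM('a) - 1))"

lemma decay_weight_pos: "decay_weight u > 0"
  by (simp add: decay_weight_def less_max_iff_disj)

lemma decay_weight_le_1: "decay_weight u \<le> 1"
  unfolding decay_weight_def by (intro inverse_le_1_iff[THEN iffD2] disjI2 one_le_power) simp

lemma decay_weight_powr:
  assumes "norm (u::'a::euclidean_space) \<ge> 1"
  shows "decay_weight u powr s = norm u powr (- ((real DIM('a) - 1) * s))"
proof -
  have "decay_weight u = norm u powr (- real (DIM('a) - 1))"
    using assms by (simp only: decay_weight_def powr_minus max_absorb2)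
      (subst powr_realpow, linarith, simp)
  then show ?thesis
    by (simp add: powr_powr algebra_simps)
qed

text \<open>Separates the decay in |u| from the dependence on \<open>p\<close>. For |u| > 1 the
  power of the norm of \<open>norm u *\<^sub>R p\<close> factors; otherwise boundedness of
  \<open>sphere_cos\<close> is enough, as \<open>p\<close> has norm at most 1. The price is a kernel
  singular in \<open>p\<close>.\<close>

lemma sphere_cos_scaled_decay:
  "\<exists>C>0. \<forall>(u :: real^'n) (p :: real^'n). norm p \<le> 1 \<longrightarrow>
    ennreal ((sphere_cos (norm u *\<^sub>R p))\<^sup>2) \<le> ennreal (C * decay_weight u) * norm_kernel p"
proof -
  obtain C where C: "C > 0" "\<And>w :: real^'n. (sphere_cos w)\<^sup>2 \<le> C"
    "\<And>w :: real^'n. norm w ^ (CARD('n) - 1) * (sphere_cos w)\<^sup>2 \<le> C"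
    using sphere_cos_decay by metis
  have bound: "ennreal ((sphere_cos (norm u *\<^sub>R p))\<^sup>2) \<le> ennreal (C * decay_weight u) * norm_kernel p"
    if p: "norm p \<le> 1" for u p :: "real^'n"
  proof (cases "norm p ^ (CARD('n) - 1) = 0")
    case True
    then have "norm_kernel p = \<infinity>"
      by (simp add: norm_kernel_def del: power_eq_0_iff)
    then show ?thesis
      using C(1) decay_weight_pos[of u] by (simp add: ennreal_mult_top)
  next
    case False
    let ?n = "CARD('n) - 1" and ?c = "(sphere_cos (norm u *\<^sub>R p))\<^sup>2"
    have x: "norm p ^ ?n > 0"
      using False by (metis norm_ge_zero order_le_less zero_le_power)
    have "?c * norm p ^ ?n * max 1 (norm u) ^ ?n \<le> C"
    proof (cases "norm u \<le> 1")
      case True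
      have "?c * norm p ^ ?n \<le> C * 1"
        using p C by (intro mult_mono power_le_one) auto
      then show ?thesis using True by (simp add: max_absorb1)
    next
      case False
      then show ?thesis
        using C(3)[of "norm u *\<^sub>R p"] by (simp add: max_def power_mult_distrib mult_ac)
    qed
    moreover have "max 1 (norm u) ^ ?n > 0"
      by (simp add: less_max_iff_disj)
    ultimately have "?c \<le> C * decay_weight u * inverse (norm p ^ ?n)"
      using x by (simp add: decay_weight_def field_simps)
    then have "ennreal ?c \<le> ennreal (C * decay_weight u * inverse (norm p ^ ?n))"
      by (rule ennreal_leI)
    also have "\<dots> = ennreal (C * decay_weight u) * norm_kernel p"
      using x C(1) decay_weight_pos[of u]
      by (simp add: norm_kernel_def ennreal_mult inverse_ennreal less_imp_le)
    finally show ?thesis .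
  qed
  show ?thesis using C(1) bound by auto
qed

text \<open>Cauchy-Schwarz in the averaged formula: the squared product of the two
  \<open>sphere_cos\<close> factors integrates to at most a constant times the two weights, because
  the product of the kernels has finite integral \<open>K\<close>.\<close>

lemma sphere_fourier_decay:
  "\<exists>M>0. \<forall>F u v. L2_sphere (F :: (real^'m) \<times> (real^'k) \<Rightarrow> complex) \<longrightarrow> G_invariant Gk F \<longrightarrow>
    norm (sphere_fourier F (u, v)) \<le> M * L2_norm_sphere F * sqrt (decay_weight u * decay_weight v)"
proof -
  let ?S = "sphere_measure :: ((real^'m) \<times> (real^'k)) measure"
  interpret finite_measure ?S by (rule finite_measure_sphere)
  define V where "V = measure (sphere_measure :: (real^'m) measure) (sphere 0 1) *
      measure (sphere_measure :: (real^'k) measure) (sphere 0 1)"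
  have V: "V > 0"
    unfolding V_def by (intro mult_pos_pos measure_sphere_pos)
  obtain C1 where C1: "C1 > 0" "\<forall>(u :: real^'m) (p :: real^'m). norm p \<le> 1 \<longrightarrow>
    ennreal ((sphere_cos (norm u *\<^sub>R p))\<^sup>2) \<le> ennreal (C1 * decay_weight u) * norm_kernel p"
    using sphere_cos_scaled_decay by blast
  obtain C2 where C2: "C2 > 0" "\<forall>(u :: real^'k) (p :: real^'k). norm p \<le> 1 \<longrightarrow>
    ennreal ((sphere_cos (norm u *\<^sub>R p))\<^sup>2) \<le> ennreal (C2 * decay_weight u) * norm_kernel p"
    using sphere_cos_scaled_decay by blast
  define K where "K = enn2real (\<integral>\<^sup>+\<omega>. norm_kernel (fst \<omega>) * norm_kernel (snd \<omega>) \<partial>?S)"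
  have K: "K \<ge> 0" "(\<integral>\<^sup>+\<omega>. norm_kernel (fst \<omega>) * norm_kernel (snd \<omega>) \<partial>?S) = ennreal K"
    using nn_integral_sphere_norm_kernels_finite[where 'a="real^'m" and 'b="real^'k"]
    by (simp_all add: K_def ennreal_enn2real_if less_top[symmetric])
  \<comment> \<open>Read off from Cauchy-Schwarz: \<open>(V * M)^2 = C1 * C2 * (K + 1)\<close>. The
    added 1 makes \<open>M\<close> positive whatever the value of \<open>K\<close>.\<close>
  define M where "M = sqrt (C1 * C2 * (K + 1)) / V"
  have M: "M > 0"
    unfolding M_def using C1 C2 K V by (intro divide_pos_pos real_sqrt_gt_zero mult_pos_pos) auto
  have bound: "norm (sphere_fourier F (u, v)) \<le> M * L2_norm_sphere F * sqrt (decay_weight u * decay_weight v)"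
    if F: "L2_sphere F" "G_invariant Gk F" for F :: "(real^'m) \<times> (real^'k) \<Rightarrow> complex" and u v
  proof -
    have F_meas [measurable]: "F \<in> borel_measurable ?S" and F2: "integrable ?S (\<lambda>\<omega>. (norm (F \<omega>))\<^sup>2)"
      using F(1) by (auto simp: L2_sphere_def)
    \<comment> \<open>On a finite measure space square integrability gives integrability, by t \<le>
      1 + t^2.\<close>
    have F1: "integrable ?S F"
    proof (rule Bochner_Integration.integrable_bound)
      show "integrable ?S (\<lambda>\<omega>. 1 + (norm (F \<omega>))\<^sup>2)"
        using F2 by simp
      have "norm (F \<omega>) \<le> 1 + (norm (F \<omega>))\<^sup>2" for \<omega>
        using sum_squares_bound[of 1 "norm (F \<omega>)"] norm_ge_zero[of "F \<omega>"] by (simp del: norm_ge_zero)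
      then show "AE \<omega> in ?S. norm (F \<omega>) \<le> norm (1 + (norm (F \<omega>))\<^sup>2)"
        by (auto intro: order_trans)
    qed measurable
    define L where "L = L2_norm_sphere F"
    have L: "L \<ge> 0" "L\<^sup>2 = (\<integral>\<omega>. (norm (F \<omega>))\<^sup>2 \<partial>?S)"
      by (auto simp: L_def L2_norm_sphere_def)
    define g where "g \<omega> = sphere_cos (norm v *\<^sub>R snd \<omega>) * sphere_cos (norm u *\<^sub>R fst \<omega>)" for \<omega> :: "(real^'m) \<times> (real^'k)"
    have L1: "(\<lambda>\<omega>. norm u *\<^sub>R fst \<omega>) \<in> borel_measurable (borel :: ((real^'m) \<times> (real^'k)) measure)"
      "(\<lambda>\<omega>. norm v *\<^sub>R snd \<omega>) \<in> borel_measurable (borel :: ((real^'m) \<times> (real^'k)) measure)"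
      by (intro borel_measurable_continuous_onI continuous_intros)+
    have g [measurable]: "g \<in> borel_measurable ?S"
      unfolding g_def[abs_def]
      by (intro borel_measurable_sphere_measure borel_measurable_times measurable_compose[OF _ sphere_cos_measurable] L1)
    have g2: "(\<integral>\<^sup>+\<omega>. (ennreal \<bar>g \<omega>\<bar>)\<^sup>2 \<partial>?S) \<le> ennreal (C1 * decay_weight u * (C2 * decay_weight v) * K)"
    proof -
      have "(\<integral>\<^sup>+\<omega>. (ennreal \<bar>g \<omega>\<bar>)\<^sup>2 \<partial>?S) \<le>
        (\<integral>\<^sup>+\<omega>. ennreal (C1 * decay_weight u * (C2 * decay_weight v)) * (norm_kernel (fst \<omega>) * norm_kernel (snd \<omega>)) \<partial>?S)"
      proof (rule nn_integral_mono)
        fix \<omega> assume "\<omega> \<in> space ?S"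
        then have le: "norm (fst \<omega>) \<le> 1" "norm (snd \<omega>) \<le> 1"
          using norm_fst_le[of "fst \<omega>" "snd \<omega>"] norm_snd_le[of "snd \<omega>" "fst \<omega>"] by auto
        have "(ennreal \<bar>g \<omega>\<bar>)\<^sup>2 = ennreal ((sphere_cos (norm u *\<^sub>R fst \<omega>))\<^sup>2) * ennreal ((sphere_cos (norm v *\<^sub>R snd \<omega>))\<^sup>2)"
          by (simp add: g_def ennreal_power power_mult_distrib mult.commute flip: ennreal_mult)
        also have "\<dots> \<le> (ennreal (C1 * decay_weight u) * norm_kernel (fst \<omega>)) * (ennreal (C2 * decay_weight v) * norm_kernel (snd \<omega>))"
          using le by (intro mult_mono C1(2)[rule_format] C2(2)[rule_format]) auto
        also have "\<dots> = ennreal (C1 * decay_weight u * (C2 * decay_weight v)) * (norm_kernel (fst \<omega>) * norm_kernel (snd \<omega>))"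
          using C1(1) C2(1) decay_weight_pos[of u] decay_weight_pos[of v]
          by (subst ennreal_mult) (auto intro!: mult_nonneg_nonneg less_imp_le simp: mult_ac)
        finally show "(ennreal \<bar>g \<omega>\<bar>)\<^sup>2 \<le> ennreal (C1 * decay_weight u * (C2 * decay_weight v)) * (norm_kernel (fst \<omega>) * norm_kernel (snd \<omega>))" .
      qed
      also have "\<dots> = ennreal (C1 * decay_weight u * (C2 * decay_weight v)) * (\<integral>\<^sup>+\<omega>. norm_kernel (fst \<omega>) * norm_kernel (snd \<omega>) \<partial>?S)"
      proof (rule nn_integral_cmult)
        have "fst \<in> borel_measurable (borel :: ((real^'m) \<times> (real^'k)) measure)" "snd \<in> borel_measurable (borel :: ((real^'m) \<times> (real^'k)) measure)"
          by (intro borel_measurable_continuous_onI continuous_intros)+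
        then show "(\<lambda>\<omega>. norm_kernel (fst \<omega>) * norm_kernel (snd \<omega>)) \<in> borel_measurable ?S"
          by (intro borel_measurable_sphere_measure borel_measurable_times_ennreal measurable_compose[OF _ norm_kernel_measurable])
      qed
      also have "\<dots> = ennreal (C1 * decay_weight u * (C2 * decay_weight v) * K)"
        using C1(1) C2(1) K decay_weight_pos[of u] decay_weight_pos[of v]
        by (subst (2) ennreal_mult) (auto intro!: mult_nonneg_nonneg less_imp_le)
      finally show ?thesis .
    qed
    let ?H = "norm (sphere_fourier F (u, v))"
    have "ennreal (V * ?H) = ennreal (norm (\<integral>\<omega>. complex_of_real (g \<omega>) * F \<omega> \<partial>?S))"
      using sphere_fourier_averaged[OF F1 F(2), of u v] V
      by (simp add: g_def V_def[symmetric] norm_mult flip: of_real_mult)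
        (metis abs_of_pos norm_mult norm_of_real)
    also have "\<dots> \<le> (\<integral>\<^sup>+\<omega>. ennreal \<bar>g \<omega>\<bar> * ennreal (norm (F \<omega>)) \<partial>?S)"
    \<comment> \<open>A non-integrable function has Bochner integral 0 by default, so the bound
      holds in that case as well.\<close>
    proof (cases "integrable ?S (\<lambda>\<omega>. complex_of_real (g \<omega>) * F \<omega>)")
      case True
      from integral_norm_bound_ennreal[OF this] show ?thesis
        by (simp add: norm_mult ennreal_mult)
    qed (simp add: not_integrable_integral_eq)
    finally have "(ennreal (V * ?H))\<^sup>2 \<le> (\<integral>\<^sup>+\<omega>. ennreal \<bar>g \<omega>\<bar> * ennreal (norm (F \<omega>)) \<partial>?S)\<^sup>2"
      by (intro power_mono) auto
    also have "\<dots> \<le> (\<integral>\<^sup>+\<omega>. (ennreal \<bar>g \<omega>\<bar>)\<^sup>2 \<partial>?S) * (\<integral>\<^sup>+\<omega>. (ennreal (norm (F \<omega>)))\<^sup>2 \<partial>?S)"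
      by (rule Cauchy_Schwarz_nn_integral) measurable
    also have "(\<integral>\<^sup>+\<omega>. (ennreal (norm (F \<omega>)))\<^sup>2 \<partial>?S) = ennreal (L\<^sup>2)"
      unfolding L(2) by (simp add: ennreal_power nn_integral_eq_integral[OF F2])
    also have "(\<integral>\<^sup>+\<omega>. (ennreal \<bar>g \<omega>\<bar>)\<^sup>2 \<partial>?S) * ennreal (L\<^sup>2)
        \<le> ennreal (C1 * decay_weight u * (C2 * decay_weight v) * K) * ennreal (L\<^sup>2)"
      by (intro mult_right_mono g2) auto
    also have "\<dots> \<le> ennreal (C1 * decay_weight u * (C2 * decay_weight v) * (K + 1)) * ennreal (L\<^sup>2)"
      using C1(1) C2(1) decay_weight_pos[of u] decay_weight_pos[of v]
      by (intro mult_right_mono ennreal_leI mult_left_mono) auto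
    also have "\<dots> = ennreal ((V * (M * L * sqrt (decay_weight u * decay_weight v)))\<^sup>2)"
    proof -
      have "(V * (M * L * sqrt (decay_weight u * decay_weight v)))\<^sup>2 =
          C1 * decay_weight u * (C2 * decay_weight v) * (K + 1) * L\<^sup>2"
        using V C1(1) C2(1) K(1) decay_weight_pos[of u] decay_weight_pos[of v]
        by (simp add: M_def power_mult_distrib real_sqrt_mult power_divide)
      then show ?thesis
        using C1(1) C2(1) K(1) decay_weight_pos[of u] decay_weight_pos[of v]
        by (simp add: ennreal_mult less_imp_le)
    qed
    finally have "ennreal ((V * ?H)\<^sup>2) \<le> ennreal ((V * (M * L * sqrt (decay_weight u * decay_weight v)))\<^sup>2)"
      using V by (simp add: ennreal_power)
    then have "(V * ?H)\<^sup>2 \<le> (V * (M * L * sqrt (decay_weight u * decay_weight v)))\<^sup>2"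
      by (subst (asm) ennreal_le_iff) auto
    then have "V * ?H \<le> V * (M * L * sqrt (decay_weight u * decay_weight v))"
      by (rule power2_le_imp_le) (use V M L decay_weight_pos[of u] decay_weight_pos[of v] in simp)
    then show ?thesis
      using V by (simp add: L_def)
  qed
  show ?thesis using M bound by auto
qed

text \<open>The region splits into the end |v| \<ge> 1, the end |v| < 1 \<le> |u| and a bounded
  core. On each end only the weight of the long variable is kept, the other being at most 1; the two
  numerical hypotheses are the conditions of \<open>nn_integral_horn_finite\<close> for the two
  ends.\<close>

lemma decay_weight_L_alpha_majorant:
  fixes a \<alpha> q :: real
  assumes a: "a > 0" and \<alpha>: "\<alpha> > 0" and q: "q \<ge> 0"
    and 1: "(real CARD('m) - 1) * (q / 2) + 1 / \<alpha> * real CARD('k) > real CARD('m)"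
    and 2: "(real CARD('k) - 1) * (q / 2) + \<alpha> * real CARD('m) > real CARD('k)"
  shows "\<exists>g :: (real^'m) \<times> (real^'k) \<Rightarrow> ennreal.
    g \<in> borel_measurable borel \<and> (\<integral>\<^sup>+x. g x \<partial>lborel) < \<infinity> \<and>
    (\<forall>u v. (u, v) \<in> L_alpha a \<alpha> \<longrightarrow> ennreal ((decay_weight u * decay_weight v) powr (q / 2)) \<le> g (u, v))"
proof -
  let ?t1 = "(real CARD('m) - 1) * (q / 2)" and ?t2 = "(real CARD('k) - 1) * (q / 2)"
  \<comment> \<open>The horn inequality solved for |v|: |u| \<le> a |v|^(-\<alpha>) becomes |v|
    \<le> a^(1/\<alpha>) |u|^(-1/\<alpha>).\<close>
  define g1 where "g1 x = ennreal (norm (fst x) powr (- ?t1)) *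
    indicator {(x, y). norm x \<ge> 1 \<and> norm y \<le> a powr (1 / \<alpha>) * norm x powr (- (1 / \<alpha>))} x" for x :: "(real^'m) \<times> (real^'k)"
  \<comment> \<open>The coordinates are swapped so that the long variable comes first, as in
    \<open>nn_integral_horn_finite\<close>; \<open>g\<close> swaps them back.\<close>
  define g2 where "g2 x = ennreal (norm (fst x) powr (- ?t2)) *
    indicator {(x, y). norm x \<ge> 1 \<and> norm y \<le> a * norm x powr (- \<alpha>)} x" for x :: "(real^'k) \<times> (real^'m)"
  define g3 where "g3 x = (indicator (cball 0 1 \<times> cball 0 1) x :: ennreal)" for x :: "(real^'m) \<times> (real^'k)"
  define g where "g x = g1 x + g2 (snd x, fst x) + g3 x" for x :: "(real^'m) \<times> (real^'k)"
  have horn: "{(x, y). norm x \<ge> 1 \<and> norm y \<le> A * norm x powr \<beta>} \<in> sets (borel :: ('x::euclidean_space \<times> 'y::euclidean_space) measure)"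
    for A \<beta> :: real
  proof -
    have "Measurable.pred (borel \<Otimes>\<^sub>M borel) (\<lambda>x :: 'x \<times> 'y. norm (fst x) \<ge> 1 \<and> norm (snd x) \<le> A * norm (fst x) powr \<beta>)"
      by measurable
    moreover have "{(x :: 'x, y :: 'y). norm x \<ge> 1 \<and> norm y \<le> A * norm x powr \<beta>} =
        {x. norm (fst x) \<ge> 1 \<and> norm (snd x) \<le> A * norm (fst x) powr \<beta>}"
      by auto
    ultimately show ?thesis
      by (simp add: borel_prod pred_def)
  qed
  have powr: "(\<lambda>x. ennreal (norm (fst x) powr \<beta>)) \<in> borel_measurable (borel :: ('x::euclidean_space \<times> 'y::euclidean_space) measure)"
    for \<beta> :: real
  proof -
    have "(\<lambda>x. ennreal (norm (fst x) powr \<beta>)) \<in> borel_measurable (borel \<Otimes>\<^sub>M borel :: ('x \<times> 'y) measure)"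
      by measurable
    then show ?thesis
      by (simp add: borel_prod)
  qed
  have g1 [measurable]: "g1 \<in> borel_measurable borel" and g2 [measurable]: "g2 \<in> borel_measurable borel"
    unfolding g1_def[abs_def] g2_def[abs_def]
    by (intro borel_measurable_times_ennreal powr borel_measurable_indicator horn)+
  have g3 [measurable]: "g3 \<in> borel_measurable borel"
    unfolding g3_def[abs_def] by (intro borel_measurable_indicator borel_closed closed_Times) auto
  have swap [measurable]: "(\<lambda>x. (snd x, fst x)) \<in> (borel :: ((real^'m) \<times> (real^'k)) measure) \<rightarrow>\<^sub>M borel"
    by (intro borel_measurable_continuous_onI continuous_intros)
  have g: "g \<in> borel_measurable borel"
    unfolding g_def[abs_def] by measurable
  have "(\<integral>\<^sup>+x. g1 x \<partial>lborel) < \<infinity>"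
  proof -
    have "(\<integral>\<^sup>+x. g1 x \<partial>lborel) = (\<integral>\<^sup>+x. \<integral>\<^sup>+y. g1 (x, y) \<partial>lborel \<partial>lborel)"
      using lborel.nn_integral_fst[of g1 lborel] g1 by (simp add: lborel_prod)
    also have "\<dots> < \<infinity>"
      unfolding g1_def fst_conv using 1 by (intro nn_integral_horn_finite) auto
    finally show ?thesis .
  qed
  moreover have "(\<integral>\<^sup>+x. g2 (snd x, fst x) \<partial>lborel) < \<infinity>"
  proof -
    have "(\<integral>\<^sup>+x. g2 (snd x, fst x) \<partial>lborel) = (\<integral>\<^sup>+y. \<integral>\<^sup>+x. g2 (y, x) \<partial>lborel \<partial>lborel)"
      using lborel_pair.nn_integral_snd[of "\<lambda>x. g2 (snd x, fst x)"] measurable_compose[OF swap g2]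
      by (simp add: lborel_prod)
    also have "\<dots> < \<infinity>"
      unfolding g2_def fst_conv using a 2 by (intro nn_integral_horn_finite) auto
    finally show ?thesis .
  qed
  moreover have "(\<integral>\<^sup>+x. g3 x \<partial>lborel) < \<infinity>"
  proof -
    have "(\<integral>\<^sup>+x. g3 x \<partial>lborel) = emeasure lborel (cball 0 1 \<times> cball 0 1 :: ((real^'m) \<times> (real^'k)) set)"
      unfolding g3_def by (intro nn_integral_indicator) (simp add: borel_closed closed_Times)
    also have "\<dots> < \<infinity>"
      by (intro emeasure_bounded_finite bounded_Times) auto
    finally show ?thesis .
  qed
  ultimately have fin: "(\<integral>\<^sup>+x. g x \<partial>lborel) < \<infinity>"
    unfolding g_def using measurable_compose[OF swap g2] by (simp add: nn_integral_add)
  have le: "ennreal ((decay_weight u * decay_weight v) powr (q / 2)) \<le> g (u, v)" if uv: "(u, v) \<in> L_alpha a \<alpha>"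
    for u :: "real^'m" and v :: "real^'k"
  proof -
    note pos = decay_weight_pos[of u] decay_weight_pos[of v] decay_weight_le_1[of u] decay_weight_le_1[of v]
    consider "norm v \<ge> 1" | "norm v < 1" "norm u \<ge> 1" | "norm v < 1" "norm u < 1" by linarith
    then show ?thesis
    proof cases
      case 1
      then have "norm u \<le> a * norm v powr (- \<alpha>)"
        using uv by (auto simp: L_alpha_def)
      then have "g2 (v, u) = ennreal (decay_weight v powr (q / 2))"
        using 1 by (simp add: g2_def decay_weight_powr)
      moreover have "(decay_weight u * decay_weight v) powr (q / 2) \<le> decay_weight v powr (q / 2)"
        using pos q by (intro powr_mono2) (auto simp: mult_le_cancel_right1)
      ultimately have "ennreal ((decay_weight u * decay_weight v) powr (q / 2)) \<le> g2 (v, u)"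
        by (simp add: ennreal_leI)
      also have "\<dots> \<le> g (u, v)"
        by (simp add: g_def add_increasing add_increasing2)
      finally show ?thesis .
    next
      case 2
      have "norm v \<le> a powr (1 / \<alpha>) * norm u powr (- (1 / \<alpha>))"
      \<comment> \<open>Points with \<open>v = 0\<close> lie in \<open>L_alpha\<close> by convention
        and satisfy the solved inequality trivially.\<close>
      proof (cases "v = 0")
        case False
        then have v: "norm v > 0" by simp
        have "norm u \<le> a * norm v powr (- \<alpha>)"
          using uv False by (auto simp: L_alpha_def)
        then have "norm v powr \<alpha> \<le> a / norm u"
          using v 2 less_le_trans[OF zero_less_one 2(2)] by (simp add: powr_minus divide_inverse[symmetric] le_divide_eq mult.commute)
        then have "(norm v powr \<alpha>) powr (1 / \<alpha>) \<le> (a / norm u) powr (1 / \<alpha>)"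
          using \<alpha> by (intro powr_mono2) auto
        moreover have "(norm v powr \<alpha>) powr (1 / \<alpha>) = norm v"
          using \<alpha> v by (simp add: powr_powr)
        moreover have "(a / norm u) powr (1 / \<alpha>) = a powr (1 / \<alpha>) * norm u powr (- (1 / \<alpha>))"
          by (simp add: powr_divide powr_minus_divide)
        ultimately show ?thesis by simp
      qed simp
      then have "g1 (u, v) = ennreal (decay_weight u powr (q / 2))"
        using 2 by (simp add: g1_def decay_weight_powr)
      moreover have "(decay_weight u * decay_weight v) powr (q / 2) \<le> decay_weight u powr (q / 2)"
        using pos q by (intro powr_mono2) (auto simp: mult_le_cancel_left1)
      ultimately have "ennreal ((decay_weight u * decay_weight v) powr (q / 2)) \<le> g1 (u, v)"
        by (simp add: ennreal_leI)
      also have "\<dots> \<le> g (u, v)"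
        by (simp add: g_def add_increasing2 add.assoc)
      finally show ?thesis .
    next
      case 3
      have "(decay_weight u * decay_weight v) powr (q / 2) \<le> 1 powr (q / 2)"
        using pos q by (intro powr_mono2 mult_le_one) auto
      then have "ennreal ((decay_weight u * decay_weight v) powr (q / 2)) \<le> g3 (u, v)"
        using 3 by (simp add: g3_def)
      also have "\<dots> \<le> g (u, v)"
        by (simp add: g_def add_increasing)
      finally show ?thesis .
    qed
  qed
  show ?thesis
    by (intro exI[of _ g] conjI allI impI g fin le)
qed

section \<open>Integrating the \<open>q\<close>-th power of the pointwise bound\<close>

theorem theorem1p2:
  fixes a \<alpha> q :: real
  assumes "CARD('m::finite) + CARD('k::finite) \<ge> 3"
    and "a > 0" and "\<alpha> > 0"
    and "CARD('k) = 1 \<Longrightarrow> \<alpha> > 1 / (real (CARD('m) + CARD('k)) - 1)"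
    and "CARD('k) = CARD('m) + CARD('k) - 1 \<Longrightarrow> \<alpha> < real (CARD('m) + CARD('k)) - 1"
    and "q \<ge> 1"
    and "q > lambda_Nk (CARD('m) + CARD('k)) CARD('k) \<alpha>"
  shows "admissible_triple (Gk :: ((real^'m) \<times> (real^'k) \<Rightarrow> (real^'m) \<times> (real^'k)) set) q
           (indicator (L_alpha a \<alpha> :: ((real^'m) \<times> (real^'k)) set))"
proof -
  have q: "q \<ge> 0" "q > 0" using assms(6) by auto
  have "CARD('m) \<ge> 1" "CARD('k) \<ge> 1"
    by (simp_all add: Suc_le_eq)
  from lambda_Nk_exponents[OF this assms(1,3) assms(4,5,7)]
  obtain g :: "(real^'m) \<times> (real^'k) \<Rightarrow> ennreal" where g: "g \<in> borel_measurable borel" "(\<integral>\<^sup>+x. g x \<partial>lborel) < \<infinity>"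
    and g_le: "\<forall>u v. (u, v) \<in> L_alpha a \<alpha> \<longrightarrow> ennreal ((decay_weight u * decay_weight v) powr (q / 2)) \<le> g (u, v)"
    using decay_weight_L_alpha_majorant[OF assms(2,3) q(1)] by blast
  define K where "K = enn2real (\<integral>\<^sup>+x. g x \<partial>lborel)"
  have K: "K \<ge> 0" "(\<integral>\<^sup>+x. g x \<partial>lborel) = ennreal K"
    using g(2) by (simp_all add: K_def ennreal_enn2real_if less_top[symmetric])
  obtain M where M: "M > 0" "\<forall>F u v. L2_sphere (F :: (real^'m) \<times> (real^'k) \<Rightarrow> complex) \<longrightarrow> G_invariant Gk F \<longrightarrow>
    norm (sphere_fourier F (u, v)) \<le> M * L2_norm_sphere F * sqrt (decay_weight u * decay_weight v)"
    using sphere_fourier_decay by blast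
  define c where "c = (2 * pi) powr (- real DIM((real^'m) \<times> (real^'k)) / 2)"
  have c: "c > 0" by (simp add: c_def)
  \<comment> \<open>Chosen so that \<open>C powr q = (c * M) powr q * (K + 1)\<close>, with
    \<open>K\<close> the integral of the majorant; the added 1 keeps \<open>C\<close>
    positive.\<close>
  define C where "C = c * M * (K + 1) powr (1 / q)"
  have C: "C > 0" using c M K by (simp add: C_def)
  show ?thesis
    unfolding admissible_triple_def
  proof (intro exI[of _ C] conjI C allI impI; elim conjE)
    fix F :: "(real^'m) \<times> (real^'k) \<Rightarrow> complex"
    assume F: "L2_sphere F" "G_invariant Gk F"
    define L where "L = L2_norm_sphere F"
    have L: "L \<ge> 0" by (simp add: L_def L2_norm_sphere_def)
    have "ennreal (norm (indicator (L_alpha a \<alpha>) x * ext_sigma F x) powr q) \<le> ennreal ((c * M * L) powr q) * g x" for x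
    proof (cases "x \<in> L_alpha a \<alpha>")
      case True
      obtain u v where x: "x = (u, v)" by (cases x)
      let ?w = "decay_weight u * decay_weight v"
      have w: "?w > 0" using decay_weight_pos[of u] decay_weight_pos[of v] by simp
      have "norm (ext_sigma F x) = c * norm (sphere_fourier F x)"
        using c by (simp add: ext_sigma_def sphere_fourier_def norm_mult c_def)
      also have "\<dots> \<le> c * (M * L * sqrt ?w)"
        using M(2)[rule_format, OF F, of u v] c by (simp add: x L_def)
      finally have "norm (ext_sigma F x) powr q \<le> (c * M * L * sqrt ?w) powr q"
        using q by (intro powr_mono2) (auto simp: mult_ac)
      also have "\<dots> = (c * M * L) powr q * ?w powr (q / 2)"
        using c M(1) L w by (simp add: powr_mult powr_powr flip: powr_half_sqrt)
      finally have "ennreal (norm (ext_sigma F x) powr q) \<le> ennreal ((c * M * L) powr q) * ennreal (?w powr (q / 2))"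
        by (simp add: ennreal_leI flip: ennreal_mult)
      also have "\<dots> \<le> ennreal ((c * M * L) powr q) * g x"
        using g_le[rule_format, of u v] True x by (intro mult_left_mono) auto
      finally show ?thesis using True by simp
    \<comment> \<open>Outside \<open>L_alpha\<close> the integrand is
      \<open>0 powr q = 0\<close>.\<close>
    qed (use q in simp)
    then have "(\<integral>\<^sup>+x. ennreal (norm (indicator (L_alpha a \<alpha>) x * ext_sigma F x) powr q) \<partial>lborel)
        \<le> (\<integral>\<^sup>+x. ennreal ((c * M * L) powr q) * g x \<partial>lborel)"
      by (intro nn_integral_mono)
    also have "\<dots> = ennreal ((c * M * L) powr q * K)"
      using g(1) K by (simp add: nn_integral_cmult ennreal_mult)
    also have "\<dots> \<le> ennreal ((C * L) powr q)"
    proof (rule ennreal_leI)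
      have "(C * L) powr q = (c * M * L) powr q * (K + 1)"
        using c M(1) L K(1) q by (simp add: C_def powr_mult powr_powr mult_ac)
      then show "(c * M * L) powr q * K \<le> (C * L) powr q"
        by (simp add: mult_left_mono)
    qed
    finally show "(\<integral>\<^sup>+x. ennreal (norm (indicator (L_alpha a \<alpha>) x * ext_sigma F x) powr q) \<partial>lborel)
        \<le> ennreal ((C * L2_norm_sphere F) powr q)"
      by (simp add: L_def)
  qed
qed

end
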